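(* Let $n\ge 2$ and let $\Phi:\mathcal{K}^n\to\mathcal{K}^n$ be an operator in $\mathbf{MAdd}^{s,+}$ that satisfies (VC). Then there exist a continuous and strictly positive function $\rho_1:\mathrm{Gr}(n,1)\to\mathbb{R}$ and a bijective bi-Lipschitz map $\pi_1:\mathrm{Gr}(n,1)\to\mathrm{Gr}(n,1)$ such that for every generalized zonoid $Z$ with generating measure $\rho_Z$, $$h(\Phi(Z),u)=\frac12\int_{\mathbb{S}^{n-1}}\rho_1(E_v)\,V_1\big([-u,u]\,|\,\pi_1(E_v)\big)\,d\rho_Z(v)\quad\text{for all }u\in\mathbb{R}^n,$$ where $E_v=\mathrm{span}\{v\}$ for $v\in\mathbb{S}^{n-1}$.
   Context: $\mathcal{K}^n$ is the set of (nonempty) compact convex subsets of $\mathbb{R}^n$ with Minkowski addition and the Hausdorff metric $d_H$; $V_n$ is $n$-dimensional volume. $\mathbf{MAdd}^{s,+}$ is the set of operators $\Phi:\mathcal{K}^n\to\mathcal{K}^n$ that are Minkowski additive ($\Phi(K+L)=\Phi(K)+\Phi(L)$), continuous in the Hausdorff metric, translation invariant ($\Phi(K+t)=\Phi(K)$ for $t\in\mathbb{R}^n$), and satisfy $\Phi(-K)=\Phi(K)=-\Phi(K)$ for all $K$. $\Phi$ satisfies (VC) if there are constants $c_\Phi,C_\Phi>0$ with $c_\Phi V_n(K)\leq V_n(\Phi(K))\leq C_\Phi V_n(K)$ for all $K\in\mathcal{K}^n$. $\mathrm{Gr}(n,1)$ is the set of lines through the origin in $\mathbb{R}^n$ with the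 metric $d(E,F)=d_H(E\cap\mathbb{S}^{n-1},F\cap\mathbb{S}^{n-1})$. A bijection $\pi$ of $\mathrm{Gr}(n,1)$ is bi-Lipschitz if there are $c,C>0$ with $c\,d(E,F)\leq d(\pi(E),\pi(F))\leq C\,d(E,F)$ for all $E,F$. $h(K,u)=\max_{x\in K}\langle u,x\rangle$ is the support function. $A|E$ is the orthogonal projection of $A$ onto the subspace $E$, and $V_1$ is length. A convex body $Z\in\mathcal{K}^n$ is a generalized zonoid with generating measure $\rho_Z$ if $\rho_Z$ is a (finite) signed even Borel measure on $\mathbb{S}^{n-1}$ and, for some fixed $v_0\in\mathbb{R}^n$, $h(Z,u)=\int_{\mathbb{S}^{n-1}}|\langle u,v\rangle|\,d\rho_Z(v)+\langle u,v_0\rangle$ for all $u\in\mathbb{R}^n$. *)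

theory Defs
  imports "HOL-Analysis.Analysis" "HOL-Library.Set_Algebras"
begin

section \<open>Metric notions relative to an explicit distance function\<close>

definition hausdorff_distance :: "'a::metric_space set \<Rightarrow> 'a set \<Rightarrow> real" where
  "hausdorff_distance A B = max (SUP a\<in>A. infdist a B) (SUP b\<in>B. infdist b A)"

definition continuous_wrt ::
    "'a set \<Rightarrow> ('a \<Rightarrow> 'a \<Rightarrow> real) \<Rightarrow> ('b \<Rightarrow> 'b \<Rightarrow> real) \<Rightarrow> ('a \<Rightarrow> 'b) \<Rightarrow> bool" where
  "continuous_wrt X d d' f \<longleftrightarrow>
     (\<forall>x\<in>X. \<forall>\<epsilon>>0. \<exists>\<delta>>0. \<forall>y\<in>X. d x y < \<delta> \<longrightarrow> d' (f x) (f y) < \<epsilon>)"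

definition bi_lipschitz_wrt :: "'a set \<Rightarrow> ('a \<Rightarrow> 'a \<Rightarrow> real) \<Rightarrow> ('a \<Rightarrow> 'a) \<Rightarrow> bool" where
  "bi_lipschitz_wrt X d f \<longleftrightarrow>
     (\<exists>c>0. \<exists>C>0. \<forall>x\<in>X. \<forall>y\<in>X. c * d x y \<le> d (f x) (f y) \<and> d (f x) (f y) \<le> C * d x y)"


section \<open>Convex bodies and Minkowski additive operators\<close>

definition convex_bodies :: "'a::euclidean_space set set" where
  "convex_bodies = {K. K \<noteq> {} \<and> compact K \<and> convex K}"

definition support_function :: "'a::euclidean_space set \<Rightarrow> 'a \<Rightarrow> real" where
  "support_function K u = (SUP x\<in>K. u \<bullet> x)"

text \<open>On sets, \<open>K + L\<close> is the Minkowski sum, but \<open>- K\<close> would be the complement; the reflection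
  of \<open>K\<close> in the origin is \<open>uminus ` K\<close>. Operators are total functions of which only the values on
  \<^const>\<open>convex_bodies\<close> matter.\<close>

definition MAdd_sym :: "('a::euclidean_space set \<Rightarrow> 'a set) set" where
  "MAdd_sym = {\<Phi>.
     \<Phi> \<in> convex_bodies \<rightarrow> convex_bodies \<and>
     (\<forall>K\<in>convex_bodies. \<forall>L\<in>convex_bodies. \<Phi> (K + L) = \<Phi> K + \<Phi> L) \<and>
     continuous_wrt convex_bodies hausdorff_distance hausdorff_distance \<Phi> \<and>
     (\<forall>K\<in>convex_bodies. \<forall>t. \<Phi> ((\<lambda>x. x + t) ` K) = \<Phi> K) \<and>
     (\<forall>K\<in>convex_bodies. \<Phi> (uminus ` K) = \<Phi> K \<and> \<Phi> K = uminus ` \<Phi> K)}"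

definition volume_condition :: "('a::euclidean_space set \<Rightarrow> 'a set) \<Rightarrow> bool" where
  "volume_condition \<Phi> \<longleftrightarrow>
     (\<exists>c>0. \<exists>C>0. \<forall>K\<in>convex_bodies.
        c * measure lebesgue K \<le> measure lebesgue (\<Phi> K) \<and>
        measure lebesgue (\<Phi> K) \<le> C * measure lebesgue K)"


section \<open>Lines through the origin\<close>

definition Gr1 :: "'a::euclidean_space set set" where
  "Gr1 = {E. subspace E \<and> dim E = 1}"

definition Gr1_dist :: "'a::euclidean_space set \<Rightarrow> 'a set \<Rightarrow> real" where
  "Gr1_dist E F = hausdorff_distance (E \<inter> sphere 0 1) (F \<inter> sphere 0 1)"

definition orth_proj :: "'a::euclidean_space set \<Rightarrow> 'a \<Rightarrow> 'a" where
  "orth_proj E x = (THE y. y \<in> E \<and> (\<forall>z\<in>E. orthogonal (x - y) z))"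

text \<open>Length of a subset \<open>A\<close> of a line \<open>E \<in> Gr1\<close>: the Lebesgue measure of \<open>A\<close> in an isometric
  coordinate \<open>t \<mapsto> t w\<close> of \<open>E\<close>. The two possible unit vectors \<open>w\<close> give the same value.\<close>

definition line_length :: "'a::euclidean_space set \<Rightarrow> 'a set \<Rightarrow> real" where
  "line_length E A =
     measure lebesgue {t::real. t *\<^sub>R (SOME w. w \<in> E \<and> norm w = 1) \<in> A}"


section \<open>Finite signed measures\<close>

definition signed_measure :: "'a measure \<Rightarrow> ('a set \<Rightarrow> real) \<Rightarrow> bool" where
  "signed_measure M \<rho> \<longleftrightarrow>
     \<rho> {} = 0 \<and>
     (\<forall>A::nat \<Rightarrow> 'a set. range A \<subseteq> sets M \<longrightarrow> disjoint_family A \<longrightarrow>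
        (\<lambda>i. \<rho> (A i)) sums \<rho> (\<Union>i. A i))"

text \<open>The positive part of the Jordan decomposition,
  \<open>\<rho>\<^sup>+(A) = sup {\<rho>(B) | B \<subseteq> A measurable}\<close>. As \<^const>\<open>ennreal\<close> sends negative numbers to \<open>0 = \<rho>({})\<close>,
  it does not affect the supremum. The negative part is the positive part of \<open>- \<rho>\<close>.\<close>

definition positive_variation :: "'a measure \<Rightarrow> ('a set \<Rightarrow> real) \<Rightarrow> 'a measure" where
  "positive_variation M \<rho> =
     measure_of (space M) (sets M) (\<lambda>A. SUP B\<in>{B \<in> sets M. B \<subseteq> A}. ennreal (\<rho> B))"

definition signed_integral :: "'a measure \<Rightarrow> ('a set \<Rightarrow> real) \<Rightarrow> ('a \<Rightarrow> real) \<Rightarrow> real" where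
  "signed_integral M \<rho> f =
     integral\<^sup>L (positive_variation M \<rho>) f - integral\<^sup>L (positive_variation M (\<lambda>A. - \<rho> A)) f"


section \<open>Generalized zonoids\<close>

definition sphere_borel :: "'a::euclidean_space measure" where
  "sphere_borel = restrict_space borel (sphere 0 1)"

definition generating_measure :: "'a::euclidean_space set \<Rightarrow> ('a set \<Rightarrow> real) \<Rightarrow> bool" where
  "generating_measure Z \<rho> \<longleftrightarrow>
     signed_measure sphere_borel \<rho> \<and>
     (\<forall>A\<in>sets sphere_borel. \<rho> (uminus ` A) = \<rho> A) \<and>
     (\<exists>v\<^sub>0. \<forall>u. support_function Z u = signed_integral sphere_borel \<rho> (\<lambda>v. \<bar>u \<bullet> v\<bar>) + u \<bullet> v\<^sub>0)"

end

theory Submission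
  imports Defs
begin

text \<open>
  Write \<open>I\<^sub>v = [-v, v]\<close>. If \<open>v\<^sub>1, \<dots>, v\<^sub>n\<close> is a basis, the sum of the \<open>I\<^bsub>v\<^sub>i\<^esub>\<close> has positive volume, but omitting a
  summand makes it null. By the volume condition the same holds for the bodies \<open>\<Phi>(I\<^bsub>v\<^sub>i\<^esub>)\<close>, so each of
  them adds exactly one dimension to the span of the others; hence \<open>\<Phi>(I\<^sub>v) = [-g(v), g(v)]\<close> is a segment, and
  \<open>\<pi>\<^sub>1(E\<^sub>v)\<close> is the line through \<open>g(v)\<close> while \<open>\<rho>\<^sub>1(E\<^sub>v) = |g(v)|\<close> for unit \<open>v\<close>. The volume of a parallelepiped with
  two edges \<open>v, w\<close> of bounded length and bounded further edges is at most a multiple of the distance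
  of the lines of \<open>v, w\<close>, and a suitable choice of the further edges makes it at least such a multiple.
  Comparing with the image under \<open>\<Phi>\<close> makes \<open>\<pi>\<^sub>1\<close> bi-Lipschitz, once it is known to be surjective by
  invariance of domain. The integral formula holds for finite sums of segments, hence by continuity
  for zonoids, and by the Jordan decomposition and additivity for generalized zonoids.
\<close>

section \<open>Support functions and the Hausdorff distance\<close>

text \<open>The vector \<open>g v\<close> is determined only up to sign, and no global continuous
  choice of the sign is made. Everything is therefore phrased through |u \<bullet> g v|, the support
  function of the image segment: it inherits additivity and continuity from \<Phi>, and it
  determines \<open>g v\<close> up to sign. The two Lipschitz bounds are not symmetric. For the
  lower one, the further edges are chosen for \<open>v\<close> and \<open>w\<close> themselves, and
  of their images only boundedness matters. For the upper one the volume has to be large on the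
  image side, so the further edges must be images under \<open>g\<close>: this is what surjectivity
  is for. Surjectivity in turn rests on injectivity up to sign, a consequence of the lower bound.
  Hence the order lower bound, surjectivity, upper bound. Volumes are estimated without
  determinants: from above by packing translates of a slab into a ball, from below by covering a
  ball with translates of a parallelepiped.\<close>

lemma bdd_above_inner_image:
  fixes K :: "'a::euclidean_space set"
  assumes "compact K" shows "bdd_above ((\<bullet>) u ` K)"
  by (intro bounded_imp_bdd_above compact_imp_bounded compact_continuous_image continuous_intros assms)

lemma inner_le_support_function:
  fixes K :: "'a::euclidean_space set"
  assumes "compact K" "x \<in> K" shows "u \<bullet> x \<le> support_function K u"
  unfolding support_function_def
  using assms(2) bdd_above_inner_image[OF assms(1)] by (rule cSUP_upper)

lemma support_function_attained:
  fixes K :: "'a::euclidean_space set"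
  assumes "compact K" "K \<noteq> {}"
  obtains x where "x \<in> K" "support_function K u = u \<bullet> x"
proof -
  obtain x where x: "x \<in> K" "\<forall>y\<in>K. u \<bullet> y \<le> u \<bullet> x"
    using continuous_attains_sup[OF assms, of "(\<bullet>) u"] by (auto simp: continuous_on_inner)
  then have "support_function K u = u \<bullet> x"
    unfolding support_function_def by (intro cSup_eq_maximum) auto
  with x that show ?thesis by blast
qed

lemma support_function_eqI:
  fixes K :: "'a::euclidean_space set"
  assumes "x \<in> K" "\<And>y. y \<in> K \<Longrightarrow> u \<bullet> y \<le> u \<bullet> x"
  shows "support_function K u = u \<bullet> x"
  unfolding support_function_def using assms by (intro cSup_eq_maximum) auto

lemma convex_bodiesD:
  assumes "K \<in> convex_bodies" shows "K \<noteq> {}" "compact K" "convex K" "closed K"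
  using assms by (auto simp: convex_bodies_def compact_imp_closed)

lemma support_function_plus:
  fixes K L :: "'a::euclidean_space set"
  assumes "K \<in> convex_bodies" "L \<in> convex_bodies"
  shows "support_function (K + L) u = support_function K u + support_function L u"
proof -
  obtain x where x: "x \<in> K" "support_function K u = u \<bullet> x"
    using assms support_function_attained convex_bodiesD by metis
  obtain y where y: "y \<in> L" "support_function L u = u \<bullet> y"
    using assms support_function_attained convex_bodiesD by metis
  have "support_function (K + L) u = u \<bullet> (x + y)"
  proof (rule support_function_eqI)
    show "x + y \<in> K + L" using x y by auto
    fix z assume "z \<in> K + L"
    then obtain a b where "a \<in> K" "b \<in> L" "z = a + b" by (auto elim: set_plus_elim)
    then show "u \<bullet> z \<le> u \<bullet> (x + y)"
      using inner_le_support_function[of K a u] inner_le_support_function[of L b u] x y assms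
      by (auto simp: convex_bodiesD inner_add_right)
  qed
  then show ?thesis using x y by (simp add: inner_add_right)
qed

lemma support_function_translation:
  fixes K :: "'a::euclidean_space set"
  assumes "K \<in> convex_bodies"
  shows "support_function ((\<lambda>x. x + t) ` K) u = support_function K u + u \<bullet> t"
proof -
  obtain x where x: "x \<in> K" "support_function K u = u \<bullet> x"
    using assms support_function_attained convex_bodiesD by metis
  have "support_function ((\<lambda>x. x + t) ` K) u = u \<bullet> (x + t)"
    using x inner_le_support_function[of K _ u] assms
    by (intro support_function_eqI) (auto simp: convex_bodiesD inner_add_right)
  then show ?thesis using x by (simp add: inner_add_right)
qed

lemma support_function_singleton_0 [simp]: "support_function {0} u = 0"
  by (simp add: support_function_def)

lemma singleton_in_convex_bodies [simp]: "{x} \<in> convex_bodies"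
  by (simp add: convex_bodies_def)

lemma plus_in_convex_bodies [intro]:
  fixes K L :: "'a::euclidean_space set"
  assumes "K \<in> convex_bodies" "L \<in> convex_bodies"
  shows "K + L \<in> convex_bodies"
proof -
  have "K + L = {x + y |x y. x \<in> K \<and> y \<in> L}" by (auto simp: set_plus_def)
  then have "compact (K + L)" using assms compact_sums[of K L] by (simp add: convex_bodiesD)
  moreover have "K + L \<noteq> {}" using convex_bodiesD(1)[OF assms(1)] convex_bodiesD(1)[OF assms(2)]
    by (auto simp: set_plus_def)
  ultimately show ?thesis
    using assms by (simp add: convex_bodies_def convex_set_plus)
qed

lemma translation_in_convex_bodies:
  fixes K :: "'a::euclidean_space set"
  assumes "K \<in> convex_bodies" shows "(\<lambda>x. x + t) ` K \<in> convex_bodies"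
proof -
  have "(\<lambda>x. x + t) ` K = K + {t}" by (auto simp: set_plus_def)
  then show ?thesis using assms by (auto simp only: singleton_in_convex_bodies)
qed

lemma sum_in_convex_bodies:
  fixes K :: "'i \<Rightarrow> 'a::euclidean_space set"
  assumes "\<And>i. i \<in> A \<Longrightarrow> K i \<in> convex_bodies"
  shows "sum K A \<in> convex_bodies"
  using assms
  by (induction A rule: infinite_finite_induct) (auto)

lemma support_function_sum:
  fixes K :: "'i \<Rightarrow> 'a::euclidean_space set"
  assumes "\<And>i. i \<in> A \<Longrightarrow> K i \<in> convex_bodies"
  shows "support_function (sum K A) u = (\<Sum>i\<in>A. support_function (K i) u)"
  using assms
  by (induction A rule: infinite_finite_induct)
     (auto simp: support_function_plus sum_in_convex_bodies)

text \<open>Let \<open>y\<close> be the point of \<open>L\<close> closest to \<open>a\<close> and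
  \<open>u\<close> the unit vector from \<open>y\<close> towards \<open>a\<close>. Then
  \<open>u\<close> supports \<open>L\<close> at \<open>y\<close>, so in the direction
  \<open>u\<close> the support functions differ by at least |a - y|.\<close>

lemma infdist_le_support_function_diff:
  fixes L :: "'a::euclidean_space set"
  assumes L: "L \<in> convex_bodies" and K: "compact K" "a \<in> K"
    and le: "\<And>u. norm u = 1 \<Longrightarrow> support_function K u \<le> support_function L u + \<epsilon>" and "0 \<le> \<epsilon>"
  shows "infdist a L \<le> \<epsilon>"
proof (cases "a \<in> L")
  case True then show ?thesis using \<open>0 \<le> \<epsilon>\<close> by simp
next
  case False
  define y where "y = closest_point L a"
  note L' = convex_bodiesD[OF L]
  have y: "y \<in> L" unfolding y_def using L' by (intro closest_point_in_set) auto
  with False have ne: "a \<noteq> y" by auto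
  define u where "u = (1 / norm (a - y)) *\<^sub>R (a - y)"
  have u: "norm u = 1" using ne by (simp add: u_def)
  have le_y: "u \<bullet> z \<le> u \<bullet> y" if "z \<in> L" for z
  proof -
    have "(a - y) \<bullet> (z - y) \<le> 0"
      unfolding y_def using closest_point_dot[of L z a] L' that by auto
    then have "(a - y) \<bullet> z \<le> (a - y) \<bullet> y" by (simp add: inner_diff_right)
    then show ?thesis using ne by (simp add: u_def divide_right_mono)
  qed
  have "support_function L u = u \<bullet> y" using y le_y by (rule support_function_eqI)
  moreover have "u \<bullet> a = u \<bullet> y + norm (a - y)"
  proof -
    have "u \<bullet> (a - y) = norm (a - y)"
      using ne by (simp add: u_def power2_norm_eq_inner[symmetric] power2_eq_square)
    then show ?thesis by (simp add: inner_diff_right)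
  qed
  ultimately have "norm (a - y) \<le> \<epsilon>"
    using le[OF u] inner_le_support_function[OF K, of u] by linarith
  moreover have "infdist a L \<le> dist a y" using y by (rule infdist_le)
  ultimately show ?thesis by (simp add: dist_norm)
qed

lemma subset_if_support_function_le:
  fixes K L :: "'a::euclidean_space set"
  assumes "compact K" "L \<in> convex_bodies" "\<And>u. support_function K u \<le> support_function L u"
  shows "K \<subseteq> L"
proof
  fix a assume "a \<in> K"
  then have "infdist a L \<le> 0"
    using assms by (intro infdist_le_support_function_diff[of L K]) auto
  then have "infdist a L = 0" using infdist_nonneg[of a L] by linarith
  then show "a \<in> L" using convex_bodiesD[OF assms(2)] in_closed_iff_infdist_zero by blast
qed

text \<open>Minkowski identities are checked through it on support functions, where they become
  identities of real numbers.\<close>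

lemma convex_bodies_eqI:
  fixes K L :: "'a::euclidean_space set"
  assumes "K \<in> convex_bodies" "L \<in> convex_bodies" "\<And>u. support_function K u = support_function L u"
  shows "K = L"
  using assms subset_if_support_function_le[of K L] subset_if_support_function_le[of L K]
  by (auto simp: convex_bodiesD)

text \<open>Together with \<open>support_function_diff_le\<close> this identifies the Hausdorff
  metric with the sup metric of support functions on the unit sphere, the form in which continuity
  of \<Phi> is used.\<close>

lemma hausdorff_distance_le:
  fixes K L :: "'a::euclidean_space set"
  assumes K: "K \<in> convex_bodies" and L: "L \<in> convex_bodies" and "0 \<le> \<epsilon>"
    and le: "\<And>u. norm u = 1 \<Longrightarrow> \<bar>support_function K u - support_function L u\<bar> \<le> \<epsilon>"
  shows "hausdorff_distance K L \<le> \<epsilon>"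
proof -
  have 1: "support_function K u \<le> support_function L u + \<epsilon>"
       "support_function L u \<le> support_function K u + \<epsilon>" if "norm u = 1" for u
    using le[OF that] by auto
  show ?thesis unfolding hausdorff_distance_def
    using infdist_le_support_function_diff[OF L _ _ 1(1) \<open>0 \<le> \<epsilon>\<close>]
      infdist_le_support_function_diff[OF K _ _ 1(2) \<open>0 \<le> \<epsilon>\<close>] convex_bodiesD[OF K] convex_bodiesD[OF L]
    by (auto intro!: cSUP_least)
qed

lemma bdd_above_infdist_image:
  fixes K :: "'a::metric_space set"
  assumes "compact K" shows "bdd_above ((\<lambda>a. infdist a L) ` K)"
  by (intro bounded_imp_bdd_above compact_imp_bounded compact_continuous_image
      continuous_on_infdist continuous_on_id assms)

lemma infdist_le_hausdorff_distance:
  assumes "compact K" "a \<in> K" shows "infdist a L \<le> hausdorff_distance K L"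
    "infdist a L \<le> hausdorff_distance L K"
  unfolding hausdorff_distance_def
  using cSUP_upper[OF assms(2) bdd_above_infdist_image[OF assms(1), of L]] by auto

lemma support_function_diff_le:
  fixes K L :: "'a::euclidean_space set"
  assumes K: "K \<in> convex_bodies" and L: "L \<in> convex_bodies"
  shows "\<bar>support_function K u - support_function L u\<bar> \<le> norm u * hausdorff_distance K L"
proof -
  have *: "support_function A u \<le> support_function B u + norm u * D"
    if A: "A \<in> convex_bodies" and B: "B \<in> convex_bodies" and D: "\<And>a. a \<in> A \<Longrightarrow> infdist a B \<le> D"
    for A B :: "'a set" and D
  proof -
    obtain a where a: "a \<in> A" "support_function A u = u \<bullet> a"
      using A support_function_attained convex_bodiesD by metis
    obtain b where b: "b \<in> B" "infdist a B = dist a b"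
      using infdist_attains_inf[of B a] convex_bodiesD[OF B] by metis
    have "u \<bullet> (a - b) \<le> norm u * norm (a - b)" by (rule norm_cauchy_schwarz)
    also have "\<dots> \<le> norm u * D" using D[OF a(1)] b(2) by (simp add: dist_norm mult_left_mono)
    finally show ?thesis
      using inner_le_support_function[of B b u] b convex_bodiesD[OF B] a by (simp add: inner_diff_right)
  qed
  show ?thesis
    using *[OF K L infdist_le_hausdorff_distance(1)] *[OF L K infdist_le_hausdorff_distance(2)]
      convex_bodiesD[OF K] convex_bodiesD[OF L] by fastforce
qed

section \<open>Origin-symmetric segments\<close>

definition sym_segment :: "'a::real_vector \<Rightarrow> 'a set" where
  "sym_segment v = closed_segment (- v) v"

lemma sym_segment_uminus: "sym_segment (- v) = sym_segment v"
  by (metis closed_segment_commute minus_minus sym_segment_def)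

lemma sym_segment_0 [simp]: "sym_segment 0 = {0}"
  by (simp add: sym_segment_def)

lemma mem_sym_segment:
  "x \<in> sym_segment v \<longleftrightarrow> (\<exists>t::real. \<bar>t\<bar> \<le> 1 \<and> x = t *\<^sub>R (v :: 'a::real_vector))"
proof -
  have eq: "(1 - s) *\<^sub>R (- v) + s *\<^sub>R v = (2 * s - 1) *\<^sub>R v" for s :: real
  proof -
    have "(1 - s) *\<^sub>R (- v) + s *\<^sub>R v = (s - (1 - s)) *\<^sub>R v"
      by (simp only: scaleR_left_diff_distrib scaleR_minus_right) simp
    moreover have "s - (1 - s) = 2 * s - 1" by simp
    ultimately show ?thesis by (simp only:)
  qed
  show ?thesis
  proof
    assume "x \<in> sym_segment v"
    then obtain s where "0 \<le> s" "s \<le> 1" "x = (2 * s - 1) *\<^sub>R v"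
      unfolding sym_segment_def in_segment eq by auto
    then show "\<exists>t. \<bar>t\<bar> \<le> 1 \<and> x = t *\<^sub>R v" by (intro exI[of _ "2 * s - 1"]) auto
  next
    assume "\<exists>t. \<bar>t\<bar> \<le> 1 \<and> x = t *\<^sub>R v"
    then obtain t :: real where "\<bar>t\<bar> \<le> 1" "x = t *\<^sub>R v" by auto
    then show "x \<in> sym_segment v"
      unfolding sym_segment_def in_segment eq by (intro exI[of _ "(t + 1) / 2"]) (auto simp: add_divide_distrib)
  qed
qed

lemma support_function_sym_segment [simp]:
  "support_function (sym_segment v) u = \<bar>u \<bullet> v\<bar>"
proof -
  define x where "x = (if 0 \<le> u \<bullet> v then v else - v)"
  have "support_function (sym_segment v) u = u \<bullet> x"
  proof (rule support_function_eqI)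
    show "x \<in> sym_segment v" by (simp add: x_def sym_segment_def)
    fix y assume "y \<in> sym_segment v"
    then obtain t where t: "\<bar>t\<bar> \<le> 1" "y = t *\<^sub>R v"
      by (auto simp: mem_sym_segment)
    have "u \<bullet> y = t * (u \<bullet> v)" using t by simp
    also have "\<dots> \<le> \<bar>t\<bar> * \<bar>u \<bullet> v\<bar>" by (metis abs_ge_self abs_mult)
    also have "\<dots> \<le> 1 * \<bar>u \<bullet> v\<bar>" using t by (intro mult_right_mono) auto
    finally show "u \<bullet> y \<le> u \<bullet> x" by (auto simp: x_def)
  qed
  then show ?thesis by (auto simp: x_def)
qed

lemma sym_segment_in_convex_bodies [simp]: "sym_segment v \<in> convex_bodies"
  by (simp add: convex_bodies_def sym_segment_def)

section \<open>Volumes of sums of segments\<close>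

text \<open>A convex body has positive volume iff it has interior points. Since 0 lies in
  \<open>K\<close>, its affine hull is its span, so the question becomes one of linear
  algebra.\<close>

lemma measure_pos_iff_span_UNIV:
  fixes K :: "'a::euclidean_space set"
  assumes "compact K" "convex K" "0 \<in> K"
  shows "0 < measure lebesgue K \<longleftrightarrow> span K = UNIV"
proof
  assume "0 < measure lebesgue K"
  then have "\<not> dim K < DIM('a)" using negligible_lowdim negligible_imp_measure0 by fastforce
  then show "span K = UNIV" using dim_subset_UNIV[of K] dim_eq_full[of K] by simp
next
  assume span: "span K = UNIV"
  have "affine hull K = UNIV"
    using affine_hull_span_0[of K] \<open>0 \<in> K\<close> span by (simp add: hull_inc)
  then have "interior K = rel_interior K" by (simp add: rel_interior_interior)
  also have "\<dots> \<noteq> {}" using assms rel_interior_eq_empty[of K] by auto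
  finally have "\<not> negligible K" using negligible_convex_interior assms by blast
  then show "0 < measure lebesgue K"
    using assms by (simp add: zero_less_measure_iff negligible_iff_measure0 lmeasurable_compact)
qed

section \<open>Upper volume bounds through thin slabs\<close>

lemma sum_mem_set_sum:
  assumes "\<And>i. i \<in> A \<Longrightarrow> f i \<in> K i"
  shows "sum f A \<in> sum K A"
  using assms by (induction A rule: infinite_finite_induct) auto

lemma mem_set_sumE:
  assumes "x \<in> sum K A" "finite A"
  obtains f where "x = sum f A" "\<And>i. i \<in> A \<Longrightarrow> f i \<in> K i"
  using assms set_sum_alt[of A K] by blast

text \<open>About 1/\<delta> disjoint translates of the piece of the slab fit into a ball, which
  bounds the volume of each. Shifts by multiples of 3\<delta> separate pieces of width 2\<delta>;
  for \<delta> \<le> 1 the shifts have length at most 3 + 3\<delta> \<le> 6, hence the radius R + 6.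
  For \<delta> > 1 the ball itself is a sufficient bound.\<close>

lemma measure_slab_le:
  fixes N :: "'a::euclidean_space"
  assumes N: "norm N = 1" and "0 < \<delta>" "0 \<le> R"
  shows "measure lebesgue {x. \<bar>x \<bullet> N\<bar> \<le> \<delta> \<and> norm x \<le> R} \<le> \<delta> * measure lebesgue (cball (0::'a) (R + 6))"
proof -
  define S where "S = {x::'a. \<bar>x \<bullet> N\<bar> \<le> \<delta> \<and> norm x \<le> R}"
  define B where "B = measure lebesgue (cball (0::'a) (R + 6))"
  have "compact S"
  proof -
    have "S = (\<lambda>x. x \<bullet> N) -` {-\<delta>..\<delta>} \<inter> cball 0 R" by (auto simp: S_def)
    moreover have "closed ((\<lambda>x. x \<bullet> N) -` {-\<delta>..\<delta>})"
      by (intro continuous_closed_vimage) (auto intro!: continuous_intros)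
    ultimately show ?thesis by (metis closed_Int_compact compact_cball)
  qed
  then have S: "S \<in> lmeasurable" by (rule lmeasurable_compact)
  show ?thesis
  proof (cases "\<delta> \<le> 1")
    case False
    have "measure lebesgue S \<le> B" unfolding B_def
      by (rule measure_mono_fmeasurable) (use S in \<open>auto simp: S_def\<close>)
    also have "\<dots> \<le> \<delta> * B" using False by (simp add: B_def mult_le_cancel_right1)
    finally show ?thesis by (simp add: S_def B_def)
  next
    case True
    define m where "m = nat \<lceil>1 / \<delta>\<rceil>"
    have m: "1 / \<delta> \<le> real m" "real m \<le> 1 / \<delta> + 1"
      using divide_pos_pos[of 1 \<delta>] \<open>0 < \<delta>\<close> unfolding m_def by linarith+
    define T where "T k = (+) ((3 * \<delta> * real k) *\<^sub>R N) ` S" for k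
    have T: "T k \<in> lmeasurable" "measure lebesgue (T k) = measure lebesgue S" for k
      unfolding T_def by (intro measurable_translation measure_translation S)+
    have inner_T: "\<bar>x \<bullet> N - 3 * \<delta> * real k\<bar> \<le> \<delta>" if "x \<in> T k" for x k
      using that N by (auto simp: T_def S_def inner_add_left dot_square_norm)
    have "disjoint_family_on T {..<m}"
      unfolding disjoint_family_on_def
    proof (intro ballI impI)
      fix j k :: nat assume jk: "j \<noteq> k"
      show "T j \<inter> T k = {}"
      proof (rule ccontr)
        assume "T j \<inter> T k \<noteq> {}"
        then obtain x where "x \<in> T j" "x \<in> T k" by auto
        then have "\<bar>3 * \<delta> * real j - 3 * \<delta> * real k\<bar> \<le> 2 * \<delta>" using inner_T[of x j] inner_T[of x k] by linarith
        then have "\<delta> * (3 * \<bar>real j - real k\<bar>) \<le> \<delta> * 2"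
          using \<open>0 < \<delta>\<close> by (simp add: abs_mult flip: right_diff_distrib)
        then have "3 * \<bar>real j - real k\<bar> \<le> 2" using \<open>0 < \<delta>\<close> by (subst (asm) mult_le_cancel_left_pos)
        moreover have "1 \<le> \<bar>real j - real k\<bar>" using jk by linarith
        ultimately show False by simp
      qed
    qed
    then have "measure lebesgue (\<Union>k<m. T k) = (\<Sum>k<m. measure lebesgue (T k))"
      using T by (intro measure_finite_Union) (auto simp: fmeasurableD fmeasurableD2 simp del: emeasure_completion)
    also have "\<dots> = real m * measure lebesgue S" by (simp add: T)
    finally have "real m * measure lebesgue S = measure lebesgue (\<Union>k<m. T k)" by simp
    also have "\<dots> \<le> B" unfolding B_def
    proof (rule measure_mono_fmeasurable)
      show "(\<Union>k<m. T k) \<subseteq> cball 0 (R + 6)"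
      proof clarify
        fix k x assume "k < m" "x \<in> T k"
        then obtain y where y: "y \<in> S" "x = (3 * \<delta> * real k) *\<^sub>R N + y" by (auto simp: T_def)
        have "norm x \<le> 3 * \<delta> * real k + norm y"
          unfolding y using norm_triangle_ineq[of "(3 * \<delta> * real k) *\<^sub>R N" y] N \<open>0 < \<delta>\<close> by simp
        also have "3 * \<delta> * real k \<le> 3 * \<delta> * (1 / \<delta> + 1)"
          using m \<open>k < m\<close> \<open>0 < \<delta>\<close> by (intro mult_left_mono) auto
        also have "\<dots> = 3 + 3 * \<delta>" using \<open>0 < \<delta>\<close> by (simp add: field_simps)
        finally show "x \<in> cball 0 (R + 6)" using y(1) True by (simp add: S_def)
      qed
    qed (use T in auto)
    finally have "real m * measure lebesgue S \<le> B" .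
    moreover have "1 / \<delta> * measure lebesgue S \<le> real m * measure lebesgue S"
      using m by (intro mult_right_mono) auto
    ultimately have "measure lebesgue S / \<delta> \<le> B" by simp
    then show ?thesis using \<open>0 < \<delta>\<close> by (simp add: S_def B_def field_simps)
  qed
qed

text \<open>The vectors \<open>v\<close> and \<open>f e\<close> are fewer than the dimension, so
  some unit vector \<open>N\<close> is orthogonal to all of them. Along \<open>N\<close> only the
  summand of \<open>w\<close> extends, and w \<bullet> N = (w - \<sigma> v) \<bullet> N: the body
  lies in a slab of half-width |w - \<sigma> v|. The sign \<sigma> serves both unit representatives
  of a line.\<close>

lemma sum_segments_measure_le_aux:
  fixes v w :: "'a::euclidean_space"
  assumes E: "finite E" "card E + 2 \<le> DIM('a)" and M: "norm v \<le> M" "norm w \<le> M" "\<And>e. e \<in> E \<Longrightarrow> norm (f e) \<le> M"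
    and \<sigma>: "\<bar>\<sigma>\<bar> = 1"
  shows "measure lebesgue (sym_segment v + sym_segment w + (\<Sum>e\<in>E. sym_segment (f e)))
    \<le> norm (w - \<sigma> *\<^sub>R v) * measure lebesgue (cball (0::'a) (real DIM('a) * M + 6))"
proof -
  define K where "K = sym_segment v + sym_segment w + (\<Sum>e\<in>E. sym_segment (f e))"
  \<comment> \<open>There are at most \<open>DIM('a)\<close> summands, and each contributes a vector
    of norm at most \<open>M\<close>.\<close>
  define R where "R = real DIM('a) * M"
  define B where "B = measure lebesgue (cball (0::'a) (R + 6))"
  have "0 \<le> M" using M(1) norm_ge_zero[of v] by linarith
  then have "0 \<le> R" by (simp add: R_def)
  have "dim (insert v (f ` E)) \<le> card (insert v (f ` E))" using E by (intro dim_le_card') auto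
  also have "\<dots> \<le> Suc (card (f ` E))" by (rule card_insert_le_m1) auto
  also have "\<dots> \<le> Suc (card E)" using card_image_le[OF E(1)] by simp
  finally have "dim (insert v (f ` E)) < DIM('a)" using E(2) by linarith
  then obtain N0 where N0: "N0 \<noteq> 0" "\<And>x. x \<in> span (insert v (f ` E)) \<Longrightarrow> orthogonal N0 x"
    using orthogonal_to_subspace_exists by blast
  define N where "N = N0 /\<^sub>R norm N0"
  have N: "norm N = 1" "v \<bullet> N = 0" "\<And>e. e \<in> E \<Longrightarrow> f e \<bullet> N = 0"
    using N0(1) N0(2)[OF span_base, of v] N0(2)[OF span_base, of "f _"]
    by (auto simp: N_def orthogonal_def inner_commute[of _ N0])
  have sub: "\<bar>x \<bullet> N\<bar> \<le> norm (w - \<sigma> *\<^sub>R v) \<and> norm x \<le> R" if "x \<in> K" for x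
  proof -
    from that have "x \<in> (sym_segment v + sym_segment w) + (\<Sum>e\<in>E. sym_segment (f e))"
      by (simp only: K_def)
    then obtain y z where yz: "y \<in> sym_segment v + sym_segment w" "z \<in> (\<Sum>e\<in>E. sym_segment (f e))" "x = y + z"
      by (rule set_plus_elim) blast
    obtain a b where ab: "\<bar>a\<bar> \<le> 1" "\<bar>b\<bar> \<le> 1" "y = a *\<^sub>R v + b *\<^sub>R w"
      using yz(1) by (auto simp: mem_sym_segment elim!: set_plus_elim)
    obtain h where h: "z = sum h E" "\<And>e. e \<in> E \<Longrightarrow> h e \<in> sym_segment (f e)"
      using mem_set_sumE[OF yz(2) E(1)] by blast
    have h': "h e \<bullet> N = 0" "norm (h e) \<le> M" if e: "e \<in> E" for e
    proof -
      obtain t where t: "\<bar>t\<bar> \<le> 1" "h e = t *\<^sub>R f e" using h(2)[OF e] by (auto simp: mem_sym_segment)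
      show "h e \<bullet> N = 0" using t N(3)[OF e] by simp
      have "\<bar>t\<bar> * norm (f e) \<le> 1 * M" using t(1) M(3)[OF e] by (intro mult_mono) auto
      then show "norm (h e) \<le> M" using t by simp
    qed
    have "w \<bullet> N = (w - \<sigma> *\<^sub>R v) \<bullet> N" using N(2) by (simp add: inner_diff_left)
    moreover have "x \<bullet> N = b * (w \<bullet> N)"
      unfolding yz(3) ab(3) h(1) by (simp add: inner_add_left inner_sum_left N(2) h'(1))
    ultimately have "\<bar>x \<bullet> N\<bar> = \<bar>b\<bar> * \<bar>(w - \<sigma> *\<^sub>R v) \<bullet> N\<bar>" by (simp add: abs_mult)
    also have "\<dots> \<le> 1 * (norm (w - \<sigma> *\<^sub>R v) * norm N)"
      using ab by (intro mult_mono Cauchy_Schwarz_ineq2) auto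
    finally have 1: "\<bar>x \<bullet> N\<bar> \<le> norm (w - \<sigma> *\<^sub>R v)" by (simp add: N(1))
    have "norm (a *\<^sub>R v) \<le> 1 * M" "norm (b *\<^sub>R w) \<le> 1 * M"
      unfolding norm_scaleR using ab M \<open>0 \<le> M\<close> by (intro mult_mono; simp)+
    then have "norm y \<le> 2 * M" unfolding ab(3) using norm_triangle_ineq[of "a *\<^sub>R v" "b *\<^sub>R w"] by linarith
    moreover have "norm z \<le> real (card E) * M" unfolding h(1) using h'(2) by (rule sum_norm_bound)
    ultimately have "norm x \<le> real (card E + 2) * M"
      unfolding yz(3) using norm_triangle_ineq[of y z] by (simp add: algebra_simps)
    also have "\<dots> \<le> R" unfolding R_def using E(2) \<open>0 \<le> M\<close> by (intro mult_right_mono) auto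
    finally show ?thesis using 1 by simp
  qed
  have "K \<in> convex_bodies" unfolding K_def by (intro plus_in_convex_bodies sum_in_convex_bodies) auto
  then have K: "K \<in> lmeasurable" by (intro lmeasurable_compact convex_bodiesD)
  have le: "measure lebesgue K \<le> \<delta> * B" if \<delta>: "0 < \<delta>" "norm (w - \<sigma> *\<^sub>R v) \<le> \<delta>" for \<delta>
  proof -
    have "bounded {x. \<bar>x \<bullet> N\<bar> \<le> \<delta> \<and> norm x \<le> R}"
      by (rule bounded_subset[of "cball 0 R"]) auto
    moreover have "closed {x. \<bar>x \<bullet> N\<bar> \<le> \<delta> \<and> norm x \<le> R}"
      by (intro closed_Collect_conj closed_Collect_le continuous_intros)
    ultimately have "{x. \<bar>x \<bullet> N\<bar> \<le> \<delta> \<and> norm x \<le> R} \<in> lmeasurable"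
      by (simp add: lmeasurable_compact compact_eq_bounded_closed)
    then have "measure lebesgue K \<le> measure lebesgue {x. \<bar>x \<bullet> N\<bar> \<le> \<delta> \<and> norm x \<le> R}"
      using sub \<delta>(2) K by (intro measure_mono_fmeasurable) (fastforce simp: fmeasurableD)+
    also have "\<dots> \<le> \<delta> * B" unfolding B_def using measure_slab_le[OF N(1) \<delta>(1) \<open>0 \<le> R\<close>] .
    finally show ?thesis .
  qed
  have "measure lebesgue K \<le> norm (w - \<sigma> *\<^sub>R v) * B"
  proof (cases "norm (w - \<sigma> *\<^sub>R v) > 0")
    case True then show ?thesis using le by simp
  next
    case False
    \<comment> \<open>Here w = \<sigma> v, but the slab bound asks for a positive width. Any width
      is admissible, and letting it tend to 0 shows that the body is null; the added 1 keeps the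
      denominator positive.\<close>
    have "measure lebesgue K \<le> 0 + \<epsilon>" if "0 < \<epsilon>" for \<epsilon>
    proof -
      have "measure lebesgue K \<le> \<epsilon> / (B + 1) * B" 
        using that False by (intro le) (auto simp: B_def intro!: divide_pos_pos add_nonneg_pos)
      also have "\<dots> \<le> \<epsilon> / (B + 1) * (B + 1)"
        using that by (intro mult_left_mono) (auto simp: B_def)
      also have "\<dots> = \<epsilon>"
        using measure_nonneg[of lebesgue "cball (0::'a) (R + 6)"] unfolding B_def[symmetric] by simp
      finally show ?thesis by simp
    qed
    then have "measure lebesgue K \<le> 0" by (rule field_le_epsilon)
    then show ?thesis using False by (simp add: B_def)
  qed
  then show ?thesis by (simp add: K_def B_def R_def)
qed

text \<open>The further edges are written \<open>f e\<close> because the bound is applied both to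
  images under \<open>g\<close> and to preimages of given edges. The constant depends on
  \<open>M\<close> and the dimension only.\<close>

lemma sum_segments_measure_le:
  fixes M :: real
  obtains C where "0 < C" and
    "\<And>(v::'a::euclidean_space) w E (f :: 'a \<Rightarrow> 'a). finite E \<Longrightarrow> card E + 2 \<le> DIM('a) \<Longrightarrow> norm v \<le> M \<Longrightarrow> norm w \<le> M \<Longrightarrow>
      (\<And>e. e \<in> E \<Longrightarrow> norm (f e) \<le> M) \<Longrightarrow>
      measure lebesgue (sym_segment v + sym_segment w + (\<Sum>e\<in>E. sym_segment (f e)))
        \<le> C * min (norm (v - w)) (norm (v + w))"
proof
  \<comment> \<open>The added 1 makes \<open>C\<close> positive even when the ball is null, as may
    happen for negative \<open>M\<close>.\<close>
  define C where "C = measure lebesgue (cball (0::'a) (real DIM('a) * M + 6)) + 1"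
  show "0 < C" unfolding C_def by (simp add: add_nonneg_pos)
  fix v w :: 'a and E :: "'a set" and f :: "'a \<Rightarrow> 'a"
  assume *: "finite E" "card E + 2 \<le> DIM('a)" "norm v \<le> M" "norm w \<le> M" "\<And>e. e \<in> E \<Longrightarrow> norm (f e) \<le> M"
  let ?m = "measure lebesgue (sym_segment v + sym_segment w + (\<Sum>e\<in>E. sym_segment (f e)))"
  have "?m \<le> norm (w - v) * (C - 1)" "?m \<le> norm (w + v) * (C - 1)"
    using sum_segments_measure_le_aux[OF *, where \<sigma> = 1] sum_segments_measure_le_aux[OF *, where \<sigma> = "- 1"]
    by (auto simp: C_def)
  then have "?m \<le> norm (v - w) * C" "?m \<le> norm (v + w) * C"
    by (auto simp: norm_minus_commute add.commute intro: order_trans[OF _ mult_left_mono[of "C - 1"]])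
  then show "?m \<le> C * min (norm (v - w)) (norm (v + w))" by (simp add: min_def mult.commute)
qed

section \<open>Lower volume bounds by covering a ball\<close>

lemma orthonormal_pair_extension:
  fixes v q :: "'a::euclidean_space"
  assumes "norm v = 1" "norm q = 1" "v \<bullet> q = 0"
  obtains E where "finite E" "card E + 2 = DIM('a)" "\<And>e. e \<in> E \<Longrightarrow> norm e = 1"
    "\<And>x. x = (x \<bullet> v) *\<^sub>R v + (x \<bullet> q) *\<^sub>R q + (\<Sum>e\<in>E. (x \<bullet> e) *\<^sub>R e)"
proof -
  define V where "V = {y \<in> UNIV. \<forall>x\<in>span {v, q}. orthogonal x y}"
  have V: "y \<in> V \<longleftrightarrow> v \<bullet> y = 0 \<and> q \<bullet> y = 0" for y
  proof
    assume "y \<in> V"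
    then show "v \<bullet> y = 0 \<and> q \<bullet> y = 0" by (simp add: V_def orthogonal_def span_base)
  next
    assume "v \<bullet> y = 0 \<and> q \<bullet> y = 0"
    then have "orthogonal y x" if "x \<in> span {v, q}" for x
      by (intro orthogonal_to_span[OF that]) (auto simp: orthogonal_def inner_commute)
    then show "y \<in> V" by (simp add: V_def orthogonal_commute)
  qed
  have "subspace V" by (auto simp: subspace_def V inner_add_right)
  then obtain E where E: "E \<subseteq> V" "pairwise orthogonal E" "\<And>x. x \<in> E \<Longrightarrow> norm x = 1"
    "independent E" "card E = dim V" "span E = V"
    by (rule orthonormal_basis_subspace) blast
  have fin: "finite E" using E(4) by (rule independent_imp_finite)
  have "independent {v, q}"
    using assms by (intro pairwise_orthogonal_independent) (auto simp: pairwise_def orthogonal_def inner_commute)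
  moreover have "v \<noteq> q" using assms by (auto simp: dot_square_norm)
  ultimately have "dim (span {v, q}) = 2" by (simp add: dim_eq_card_independent)
  moreover have "dim V + dim (span {v, q}) = dim (UNIV :: 'a set)"
    unfolding V_def by (rule dim_subspace_orthogonal_to_vectors) auto
  ultimately have "card E + 2 = DIM('a)" using E(5) by simp
  moreover have "x = (x \<bullet> v) *\<^sub>R v + (x \<bullet> q) *\<^sub>R q + (\<Sum>e\<in>E. (x \<bullet> e) *\<^sub>R e)" for x
  proof -
    define y where "y = x - (x \<bullet> v) *\<^sub>R v - (x \<bullet> q) *\<^sub>R q"
    have "y \<in> V" using assms
      by (simp add: V y_def inner_diff_right inner_commute[of q v] inner_commute[of _ x] dot_square_norm)
    then obtain c where c: "y = (\<Sum>e\<in>E. c e *\<^sub>R e)"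
      using E(6) span_finite[OF fin] by auto
    have "x \<bullet> e = c e" if "e \<in> E" for e
    proof -
      have "v \<bullet> e = 0" "q \<bullet> e = 0" using E(1) that V by auto
      then have "x \<bullet> e = y \<bullet> e" by (simp add: y_def inner_diff_left)
      also have "\<dots> = (\<Sum>e'\<in>E. c e' * (e' \<bullet> e))" by (simp add: c inner_sum_left)
      also have "\<dots> = (\<Sum>e'\<in>E. if e' = e then c e else 0)"
        using E(2,3) that by (intro sum.cong) (auto simp: pairwise_def orthogonal_def dot_square_norm)
      finally show ?thesis using that fin by simp
    qed
    then have "y = (\<Sum>e\<in>E. (x \<bullet> e) *\<^sub>R e)" unfolding c by (intro sum.cong) auto
    then show ?thesis by (simp add: y_def algebra_simps)
  qed
  ultimately show ?thesis using that fin E(3) by blast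
qed

text \<open>The edges \<open>E\<close> are an orthonormal basis of the complement of the plane of
  \<open>v\<close> and \<open>w\<close>. Write w = c v + s q with a unit vector \<open>q\<close>
  orthogonal to \<open>v\<close>. Translates of the parallelepiped by integer multiples of s q cover
  the ball of radius 1/2; at most 3/s of them are needed, and |v - w| \<le> 2 s because the angle is
  not obtuse. This gives the factor 1/6.\<close>

lemma sum_segments_measure_ge_aux:
  fixes v w :: "'a::euclidean_space"
  assumes vw: "norm v = 1" "norm w = 1" "0 \<le> v \<bullet> w" and "2 \<le> DIM('a)"
  shows "\<exists>E. finite E \<and> card E + 2 \<le> DIM('a) \<and> (\<forall>e\<in>E. norm e = 1) \<and>
    measure lebesgue (ball (0::'a) (1/2)) / 6 * norm (v - w)
      \<le> measure lebesgue (sym_segment v + sym_segment w + (\<Sum>e\<in>E. sym_segment e))"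
proof (cases "v = w")
  case True
  then show ?thesis using assms(4) by (intro exI[of _ "{}"]) auto
next
  case False
  define c where "c = v \<bullet> w"
  define p where "p = w - c *\<^sub>R v"
  define s where "s = norm p"
  have vv: "v \<bullet> v = 1" "w \<bullet> w = 1" using vw by (auto simp: dot_square_norm)
  have c: "0 \<le> c" "c \<le> 1" using vw norm_cauchy_schwarz[of v w] by (auto simp: c_def)
  have s2: "s\<^sup>2 = 1 - c\<^sup>2"
    unfolding s_def power2_norm_eq_inner p_def
    by (simp add: inner_diff_left inner_diff_right vv inner_commute[of w v] power2_eq_square flip: c_def)
  have vw2: "(norm (v - w))\<^sup>2 = 2 * (1 - c)"
    by (simp add: power2_norm_eq_inner inner_diff_left inner_diff_right vv inner_commute[of w v] flip: c_def)
  \<comment> \<open>From 0 \<le> c \<le> 1 follows c^2 \<le> c, so 2 (1 - c) \<le> 4 (1 -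
    c^2).\<close>
  also have "\<dots> \<le> (2 * s)\<^sup>2"
  proof -
    have "c\<^sup>2 \<le> c" using c by (simp add: power2_eq_square mult_left_le)
    then show ?thesis using c unfolding power_mult_distrib s2 by simp
  qed
  finally have le_s: "norm (v - w) \<le> 2 * s" by (rule power2_le_imp_le) (simp add: s_def)
  have s: "0 < s" using le_s False by (smt (verit) norm_eq_zero right_minus_eq norm_ge_zero)
  have "s\<^sup>2 \<le> 1\<^sup>2" unfolding s2 by simp
  then have s1: "s \<le> 1" by (rule power2_le_imp_le) simp
  define q where "q = p /\<^sub>R s"
  have q: "norm q = 1" "v \<bullet> q = 0"
    using s by (simp_all add: q_def s_def p_def inner_diff_right vv c_def)
  obtain E where E: "finite E" "card E + 2 = DIM('a)" "\<And>e. e \<in> E \<Longrightarrow> norm e = 1"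
    and decomp: "\<And>x. x = (x \<bullet> v) *\<^sub>R v + (x \<bullet> q) *\<^sub>R q + (\<Sum>e\<in>E. (x \<bullet> e) *\<^sub>R e)"
    using orthonormal_pair_extension[OF vw(1) q] by blast
  define S where "S = sym_segment v + sym_segment w + (\<Sum>e\<in>E. sym_segment e)"
  have "S \<in> convex_bodies" unfolding S_def by (intro plus_in_convex_bodies sum_in_convex_bodies) auto
  then have S: "S \<in> lmeasurable" by (intro lmeasurable_compact convex_bodiesD)
  \<comment> \<open>Shifts with |k| \<le> m suffice: x \<bullet> q is at most 1/2 in absolute value,
    and rounding its quotient by \<open>s\<close> adds at most 1/2.\<close>
  define m where "m = \<lfloor>1 / (2 * s) + 1 / 2\<rfloor>"
  define T where "T k = (+) ((real_of_int k * s) *\<^sub>R q) ` S" for k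
  have T: "T k \<in> lmeasurable" "measure lebesgue (T k) = measure lebesgue S" for k
    unfolding T_def by (intro measurable_translation measure_translation S)+
  have cover: "ball 0 (1/2) \<subseteq> (\<Union>k\<in>{-m..m}. T k)"
  proof
    fix x :: 'a assume "x \<in> ball 0 (1/2)"
    then have x: "norm x \<le> 1/2" by simp
    have inner_x: "\<bar>x \<bullet> e\<bar> \<le> 1/2" if "norm e = 1" for e
      using Cauchy_Schwarz_ineq2[of x e] that x by simp
    \<comment> \<open>Rounding leaves a remainder |r| \<le> 1/2. Substituting s q = w - c v moves it
      into the coefficients \<open>r\<close> of \<open>w\<close> and x \<bullet> v - r c of
      \<open>v\<close>, both at most 1 in absolute value.\<close>
    define k where "k = round ((x \<bullet> q) / s)"
    define r where "r = (x \<bullet> q) / s - k"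
    have r: "\<bar>r\<bar> \<le> 1/2" unfolding r_def k_def
      using of_int_round_abs_le[of "(x \<bullet> q) / s"] by (simp add: abs_minus_commute)
    have "\<bar>(x \<bullet> q) / s\<bar> \<le> 1 / (2 * s)"
      using inner_x[OF q(1)] s by (simp add: abs_divide field_simps)
    then have "\<bar>real_of_int k\<bar> \<le> 1 / (2 * s) + 1 / 2" using r unfolding r_def by linarith
    then have "k \<in> {-m..m}" unfolding m_def by (simp add: abs_le_iff) linarith
    moreover have "x \<in> T k"
    proof -
      have "x \<bullet> q = real_of_int k * s + r * s" using s by (simp add: r_def field_simps)
      moreover have "s *\<^sub>R q = w - c *\<^sub>R v" using s by (simp add: q_def p_def)
      then have "(r * s) *\<^sub>R q = r *\<^sub>R w - (r * c) *\<^sub>R v"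
        by (metis scaleR_right_diff_distrib scaleR_scaleR)
      ultimately have "(x \<bullet> q) *\<^sub>R q = (real_of_int k * s) *\<^sub>R q + (r *\<^sub>R w - (r * c) *\<^sub>R v)"
        by (simp add: scaleR_add_left)
      then have "x = (real_of_int k * s) *\<^sub>R q +
          ((x \<bullet> v - r * c) *\<^sub>R v + r *\<^sub>R w + (\<Sum>e\<in>E. (x \<bullet> e) *\<^sub>R e))"
        by (subst decomp[of x]) (simp add: scaleR_left_diff_distrib)
      moreover have "(x \<bullet> v - r * c) *\<^sub>R v + r *\<^sub>R w + (\<Sum>e\<in>E. (x \<bullet> e) *\<^sub>R e) \<in> S"
        unfolding S_def
      proof (intro set_plus_intro sum_mem_set_sum)
        have "\<bar>r * c\<bar> \<le> 1/2 * 1" unfolding abs_mult using r c by (intro mult_mono) auto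
        then have "\<bar>x \<bullet> v - r * c\<bar> \<le> 1" using inner_x[OF vw(1)] by linarith
        then show "(x \<bullet> v - r * c) *\<^sub>R v \<in> sym_segment v" by (auto simp only: mem_sym_segment)
        show "r *\<^sub>R w \<in> sym_segment w" unfolding mem_sym_segment using r by (intro exI[of _ r]) auto
        fix e assume "e \<in> E"
        then have "\<bar>x \<bullet> e\<bar> \<le> 1" using inner_x[OF E(3)[of e]] by simp
        then show "(x \<bullet> e) *\<^sub>R e \<in> sym_segment e"
          unfolding mem_sym_segment by blast
      qed
      ultimately show ?thesis unfolding T_def by (rule image_eqI)
    qed
    ultimately show "x \<in> (\<Union>k\<in>{-m..m}. T k)" by blast
  qed
  have "measure lebesgue (ball (0::'a) (1/2)) \<le> measure lebesgue (\<Union>k\<in>{-m..m}. T k)"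
    using T by (intro measure_mono_fmeasurable[OF cover] fmeasurable.finite_UN) (auto simp: lmeasurable_ball fmeasurableD)
  also have "\<dots> \<le> (\<Sum>k\<in>{-m..m}. measure lebesgue (T k))"
    using T by (intro measure_UNION_le) (auto simp: fmeasurableD)
  also have "\<dots> = real (nat (2 * m + 1)) * measure lebesgue S" by (simp add: T)
  \<comment> \<open>Indeed 2 m + 1 \<le> 1/s + 2 \<le> 3/s, as s \<le> 1.\<close>
  also have "\<dots> \<le> (3 / s) * measure lebesgue S"
  proof (intro mult_right_mono)
    have "1 \<le> 1 / s" using s s1 by simp
    have "real_of_int m \<le> 1 / (2 * s) + 1 / 2" unfolding m_def by linarith
    moreover have "0 \<le> m" unfolding m_def using s by simp
    ultimately show "real (nat (2 * m + 1)) \<le> 3 / s" using \<open>1 \<le> 1 / s\<close> by simp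
  qed auto
  finally have "measure lebesgue (ball (0::'a) (1/2)) * s / 3 \<le> measure lebesgue S"
    using s by (simp add: field_simps)
  moreover have "measure lebesgue (ball (0::'a) (1/2)) / 6 * norm (v - w)
      \<le> measure lebesgue (ball (0::'a) (1/2)) / 6 * (2 * s)"
    using le_s by (intro mult_left_mono) auto
  moreover have "measure lebesgue (ball (0::'a) (1/2)) / 6 * (2 * s)
      = measure lebesgue (ball (0::'a) (1/2)) * s / 3" by simp
  ultimately have "measure lebesgue (ball (0::'a) (1/2)) / 6 * norm (v - w) \<le> measure lebesgue S"
    by linarith
  then show ?thesis unfolding S_def using E by (intro exI[of _ E]) simp
qed

lemma sum_segments_measure_ge:
  assumes "2 \<le> DIM('a::euclidean_space)"
  obtains c where "0 < c" and
    "\<And>v w::'a. norm v = 1 \<Longrightarrow> norm w = 1 \<Longrightarrow>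
      \<exists>E. finite E \<and> card E + 2 \<le> DIM('a) \<and> (\<forall>e\<in>E. norm e = 1) \<and>
        c * min (norm (v - w)) (norm (v + w))
          \<le> measure lebesgue (sym_segment v + sym_segment w + (\<Sum>e\<in>E. sym_segment e))"
proof
  define c where "c = measure lebesgue (ball (0::'a) (1/2)) / 6"
  show "0 < c" unfolding c_def using content_ball_pos[of "1/2" "0::'a"] by (simp add: measure_completion)
  fix v w :: 'a assume vw: "norm v = 1" "norm w = 1"
  \<comment> \<open>Changing the sign of \<open>w\<close> leaves its segment alone and makes the
    angle with \<open>v\<close> non-obtuse.\<close>
  define w' where "w' = (if 0 \<le> v \<bullet> w then w else - w)"
  have "norm w' = 1" "0 \<le> v \<bullet> w'" using vw by (auto simp: w'_def)
  from sum_segments_measure_ge_aux[OF vw(1) this assms]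
  obtain E where E: "finite E" "card E + 2 \<le> DIM('a)" "\<forall>e\<in>E. norm e = 1"
    "c * norm (v - w') \<le> measure lebesgue (sym_segment v + sym_segment w' + (\<Sum>e\<in>E. sym_segment e))"
    unfolding c_def by blast
  have "sym_segment w' = sym_segment w" using sym_segment_uminus[of w] by (simp add: w'_def)
  moreover have "c * min (norm (v - w)) (norm (v + w)) \<le> c * norm (v - w')"
    using \<open>0 < c\<close> by (intro mult_left_mono) (auto simp: w'_def)
  ultimately have "c * min (norm (v - w)) (norm (v + w))
      \<le> measure lebesgue (sym_segment v + sym_segment w + (\<Sum>e\<in>E. sym_segment e))"
    using E(4) by (simp only:)
  with E(1-3) show "\<exists>E. finite E \<and> card E + 2 \<le> DIM('a) \<and> (\<forall>e\<in>E. norm e = 1) \<and>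
      c * min (norm (v - w)) (norm (v + w))
        \<le> measure lebesgue (sym_segment v + sym_segment w + (\<Sum>e\<in>E. sym_segment e))"
    by blast
qed

section \<open>Zonoids\<close>

text \<open>Greedy choice: each new set keeps only what the sets already treated leave over. This
  turns a finite cover by balls into a partition.\<close>

lemma disjoint_refinement:
  assumes "finite T" "\<And>x. x \<in> T \<Longrightarrow> B x \<in> sets M"
  shows "\<exists>A. (\<forall>x\<in>T. A x \<in> sets M \<and> A x \<subseteq> B x) \<and> disjoint_family_on A T \<and> (\<Union>x\<in>T. A x) = (\<Union>x\<in>T. B x)"
  using assms
proof (induction T rule: finite_induct)
  case empty
  show ?case by (simp add: disjoint_family_on_def)
next
  case (insert x T)
  then obtain A where A: "\<forall>x\<in>T. A x \<in> sets M \<and> A x \<subseteq> B x" "disjoint_family_on A T"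
    "(\<Union>x\<in>T. A x) = (\<Union>x\<in>T. B x)" by auto
  define A' where "A' = A(x := B x - (\<Union>y\<in>T. A y))"
  have A'_x: "A' x = B x - (\<Union>y\<in>T. A y)" by (simp add: A'_def)
  have A'_eq: "A' y = A y" if "y \<in> T" for y using that insert.hyps by (auto simp: A'_def)
  then have Un: "(\<Union>y\<in>T. A' y) = (\<Union>y\<in>T. A y)" by simp
  have "(\<Union>y\<in>T. A y) \<in> sets M" using A(1) insert.hyps by (intro sets.finite_UN) auto
  then have "\<forall>y\<in>insert x T. A' y \<in> sets M \<and> A' y \<subseteq> B y"
    using A(1) insert.prems by (auto simp: A'_x A'_eq)
  moreover have "disjoint_family_on A' (insert x T)"
  proof -
    have "disjoint_family_on A' T" using A(2) A'_eq by (simp add: disjoint_family_on_def)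
    moreover have "A' x \<inter> (\<Union>y\<in>T. A' y) = {}" unfolding Un A'_x by auto
    ultimately show ?thesis using insert.hyps by (simp add: disjoint_family_on_insert)
  qed
  moreover have "(\<Union>y\<in>insert x T. A' y) = (\<Union>y\<in>insert x T. B y)"
    unfolding UN_insert Un A'_x using A(3) by auto
  ultimately show ?case by blast
qed

lemma space_sphere_borel [simp]: "space sphere_borel = sphere 0 1"
  by (simp add: sphere_borel_def space_restrict_space)

locale finite_sphere_measure = finite_measure \<mu> for \<mu> :: "'a::euclidean_space measure" +
  assumes sets_eq: "sets \<mu> = sets sphere_borel"
begin

lemma space_eq: "space \<mu> = sphere 0 1"
  using sets_eq_imp_space_eq[OF sets_eq] by simp

lemma continuous_imp_measurable:
  fixes f :: "'a \<Rightarrow> 'b::topological_space"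
  assumes "continuous_on (sphere 0 1) f" shows "f \<in> borel_measurable \<mu>"
proof -
  have "f \<in> borel_measurable sphere_borel"
    unfolding sphere_borel_def using assms by (rule borel_measurable_continuous_on_restrict)
  then show ?thesis using measurable_cong_sets[OF sets_eq refl] by blast
qed

lemma continuous_imp_integrable:
  fixes f :: "'a \<Rightarrow> real"
  assumes "continuous_on (sphere 0 1) f" shows "integrable \<mu> f"
proof -
  have "compact (f ` sphere 0 1)" using assms by (intro compact_continuous_image) auto
  then obtain B where "\<forall>x\<in>f ` sphere 0 1. norm x \<le> B" using compact_imp_bounded bounded_iff by blast
  then show ?thesis using continuous_imp_measurable[OF assms]
    by (intro integrable_const_bound[of _ B]) (auto simp: space_eq)
qed

text \<open>The nodes and weights depend on \<delta> but not on \<open>f\<close>, so one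
  discretization serves |e \<bullet> v| for all directions \<open>e\<close> and |u \<bullet> g v| at
  the same time. The weights are the masses of a partition of the sphere into pieces of a finite
  cover by balls of radius \<delta>.\<close>

lemma discretization:
  assumes "0 < \<delta>"
  obtains T w where "finite T" "T \<subseteq> sphere 0 1" "\<And>x. x \<in> T \<Longrightarrow> (0::real) \<le> w x"
    "\<And>f \<epsilon>. continuous_on (sphere 0 1) f \<Longrightarrow>
      (\<And>x y. x \<in> sphere 0 1 \<Longrightarrow> y \<in> sphere 0 1 \<Longrightarrow> dist x y < \<delta> \<Longrightarrow> \<bar>f x - f y\<bar> \<le> \<epsilon>) \<Longrightarrow>
      \<bar>(\<Sum>x\<in>T. w x * f x) - integral\<^sup>L \<mu> f\<bar> \<le> \<epsilon> * measure \<mu> (space \<mu>)"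
proof -
  have "sphere 0 1 \<subseteq> (\<Union>x\<in>sphere 0 1. ball (x::'a) \<delta>)" using assms by auto
  then obtain T where T: "T \<subseteq> sphere 0 1" "finite T" "sphere 0 1 \<subseteq> (\<Union>x\<in>T. ball (x::'a) \<delta>)"
    by (rule compactE_image[OF compact_sphere, of "sphere 0 1" "\<lambda>x. ball x \<delta>", rotated]) auto
  have "ball x \<delta> \<inter> sphere 0 1 \<in> sets \<mu>" for x
    unfolding sets_eq sphere_borel_def sets_restrict_space by (auto simp: Int_commute)
  then obtain A where A: "\<forall>x\<in>T. A x \<in> sets \<mu> \<and> A x \<subseteq> ball x \<delta> \<inter> sphere 0 1"
    "disjoint_family_on A T" "(\<Union>x\<in>T. A x) = (\<Union>x\<in>T. ball x \<delta> \<inter> sphere 0 1)"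
    using disjoint_refinement[OF T(2), of "\<lambda>x. ball x \<delta> \<inter> sphere 0 1" \<mu>] by blast
  define w where "w x = measure \<mu> (A x)" for x
  show ?thesis
  proof (rule that[of T w])
    show "finite T" "T \<subseteq> sphere 0 1" by fact+
    show "0 \<le> w x" for x by (simp add: w_def)
    fix f :: "'a \<Rightarrow> real" and \<epsilon>
    assume f: "continuous_on (sphere 0 1) f"
      and eps: "\<And>x y. x \<in> sphere 0 1 \<Longrightarrow> y \<in> sphere 0 1 \<Longrightarrow> dist x y < \<delta> \<Longrightarrow> \<bar>f x - f y\<bar> \<le> \<epsilon>"
    define g where "g v = (\<Sum>x\<in>T. f x * indicator (A x) v)" for v
    have int_ind: "integrable \<mu> (indicator (A x) :: 'a \<Rightarrow> real)" if "x \<in> T" for x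
      using A(1) that by (intro integrable_real_indicator) (auto simp: less_top[symmetric])
    have g: "integrable \<mu> g" unfolding g_def
      using int_ind by (intro Bochner_Integration.integrable_sum integrable_mult_right) auto
    have "integral\<^sup>L \<mu> g = (\<Sum>x\<in>T. w x * f x)"
      unfolding g_def using A(1) int_ind sets.sets_into_space[of _ \<mu>]
      by (subst Bochner_Integration.integral_sum) (auto simp: w_def mult.commute Int_absorb2 intro!: sum.cong)
    then have "\<bar>(\<Sum>x\<in>T. w x * f x) - integral\<^sup>L \<mu> f\<bar> = \<bar>integral\<^sup>L \<mu> (\<lambda>v. g v - f v)\<bar>"
      using g continuous_imp_integrable[OF f] by simp
    also have "\<dots> \<le> integral\<^sup>L \<mu> (\<lambda>v. \<bar>g v - f v\<bar>)" by (rule integral_abs_bound)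
    also have "\<dots> \<le> integral\<^sup>L \<mu> (\<lambda>v. \<epsilon>)"
    proof (rule integral_mono)
      show "integrable \<mu> (\<lambda>v. \<bar>g v - f v\<bar>)" using g continuous_imp_integrable[OF f] by auto
      fix v assume "v \<in> space \<mu>"
      then have v: "v \<in> sphere 0 1" by (simp add: space_eq)
      then have "v \<in> (\<Union>x\<in>T. A x)" unfolding A(3) using T(3) by blast
      then obtain x where x: "x \<in> T" "v \<in> A x" by blast
      have "g v = (\<Sum>y\<in>T. if y = x then f x else 0)"
        unfolding g_def using A(2) x by (intro sum.cong) (auto simp: disjoint_family_on_def indicator_def)
      also have "\<dots> = f x" using x T(2) by simp
      finally have "g v = f x" .
      moreover have "x \<in> sphere 0 1" using x T(1) by blast
      moreover have "v \<in> ball x \<delta>" using A(1) x by blast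
      then have "dist x v < \<delta>" by simp
      ultimately show "\<bar>g v - f v\<bar> \<le> \<epsilon>" using eps v by simp
    qed auto
    finally show "\<bar>(\<Sum>x\<in>T. w x * f x) - integral\<^sup>L \<mu> f\<bar> \<le> \<epsilon> * measure \<mu> (space \<mu>)"
      by (simp add: mult.commute)
  qed
qed

text \<open>The candidate is the closure of the set of all moments \<open>I \<phi>\<close>, the
  integrals of \<phi>(v) v for measurable |\<phi>| \<le> 1. In the direction \<open>u\<close> the
  largest value is attained by \<phi>(v) = sgn (u \<bullet> v). Passing to the closure turns
  boundedness into compactness.\<close>

lemma zonoid_exists:
  obtains Z where "Z \<in> convex_bodies" "\<And>u. support_function Z u = integral\<^sup>L \<mu> (\<lambda>v. \<bar>u \<bullet> v\<bar>)"
proof -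
  define F where "F = {\<phi> \<in> borel_measurable \<mu>. \<forall>v. \<bar>\<phi> v :: real\<bar> \<le> 1}"
  define I where "I \<phi> = integral\<^sup>L \<mu> (\<lambda>v. \<phi> v *\<^sub>R v)" for \<phi>
  have id: "(\<lambda>v. v) \<in> borel_measurable \<mu>" by (intro continuous_imp_measurable continuous_on_id)
  have int: "integrable \<mu> (\<lambda>v. \<phi> v *\<^sub>R v)" if "\<phi> \<in> F" for \<phi>
    using that id by (intro integrable_const_bound[of _ 1]) (auto simp: F_def space_eq intro!: borel_measurable_scaleR)
  have inner_I: "u \<bullet> I \<phi> = integral\<^sup>L \<mu> (\<lambda>v. \<phi> v * (u \<bullet> v))" if "\<phi> \<in> F" for u \<phi>
    unfolding I_def using int[OF that] by (simp flip: integral_inner_right)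
  have cont: "continuous_on (sphere 0 1) (\<lambda>v. \<bar>u \<bullet> v\<bar>)" for u :: 'a by (intro continuous_intros)
  define Z where "Z = closure (I ` F)"
  have le: "u \<bullet> I \<phi> \<le> integral\<^sup>L \<mu> (\<lambda>v. \<bar>u \<bullet> v\<bar>)" if \<phi>: "\<phi> \<in> F" for u \<phi>
    unfolding inner_I[OF \<phi>]
  proof (rule integral_mono)
    show "integrable \<mu> (\<lambda>v. \<phi> v * (u \<bullet> v))" 
      using integrable_inner_right[OF int[OF \<phi>], of u] by simp
    show "integrable \<mu> (\<lambda>v. \<bar>u \<bullet> v\<bar>)" by (rule continuous_imp_integrable[OF cont])
    fix v
    have "\<phi> v * (u \<bullet> v) \<le> \<bar>\<phi> v\<bar> * \<bar>u \<bullet> v\<bar>" by (metis abs_ge_self abs_mult)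
    also have "\<dots> \<le> 1 * \<bar>u \<bullet> v\<bar>" using \<phi> by (intro mult_right_mono) (auto simp: F_def)
    finally show "\<phi> v * (u \<bullet> v) \<le> \<bar>u \<bullet> v\<bar>" by simp
  qed
  have supp: "support_function Z u = integral\<^sup>L \<mu> (\<lambda>v. \<bar>u \<bullet> v\<bar>)" for u
  proof -
    define \<phi> where "\<phi> = (\<lambda>v. sgn (u \<bullet> v))"
    have [measurable]: "(\<lambda>v. u \<bullet> v) \<in> borel_measurable \<mu>"
      by (intro continuous_imp_measurable continuous_intros)
    have "\<phi> \<in> borel_measurable \<mu>" unfolding \<phi>_def sgn_real_def by measurable
    then have \<phi>: "\<phi> \<in> F" by (auto simp: F_def \<phi>_def abs_sgn_eq)
    have eq: "u \<bullet> I \<phi> = integral\<^sup>L \<mu> (\<lambda>v. \<bar>u \<bullet> v\<bar>)"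
      unfolding inner_I[OF \<phi>] by (simp add: \<phi>_def abs_sgn mult.commute)
    have "support_function Z u = u \<bullet> I \<phi>"
    proof (rule support_function_eqI)
      show "I \<phi> \<in> Z" unfolding Z_def using \<phi> closure_subset[of "I ` F"] by blast
      have "Z \<subseteq> {y. u \<bullet> y \<le> u \<bullet> I \<phi>}"
        unfolding Z_def eq using le by (intro closure_minimal closed_halfspace_le) auto
      then show "u \<bullet> y \<le> u \<bullet> I \<phi>" if "y \<in> Z" for y using that by blast
    qed
    then show ?thesis using eq by simp
  qed
  have "convex (I ` F)"
  proof (rule convexI)
    fix x y :: 'a and a b :: real
    assume "x \<in> I ` F" "y \<in> I ` F" and ab: "0 \<le> a" "0 \<le> b" "a + b = 1"
    then obtain \<phi> \<psi> where \<phi>: "\<phi> \<in> F" "x = I \<phi>" and \<psi>: "\<psi> \<in> F" "y = I \<psi>" by blast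
    have "(\<lambda>v. a * \<phi> v + b * \<psi> v) \<in> F"
    proof -
      have "\<bar>a * \<phi> v + b * \<psi> v\<bar> \<le> 1" for v
      proof -
        have "\<bar>a * \<phi> v + b * \<psi> v\<bar> \<le> a * \<bar>\<phi> v\<bar> + b * \<bar>\<psi> v\<bar>"
          using abs_triangle_ineq[of "a * \<phi> v" "b * \<psi> v"] ab by (simp add: abs_mult)
        also have "\<dots> \<le> a * 1 + b * 1" using \<phi> \<psi> ab by (intro add_mono mult_left_mono) (auto simp: F_def)
        finally show ?thesis using ab by simp
      qed
      then show ?thesis using \<phi> \<psi> by (auto simp: F_def)
    qed
    moreover have "a *\<^sub>R x + b *\<^sub>R y = I (\<lambda>v. a * \<phi> v + b * \<psi> v)"
      unfolding \<phi>(2) \<psi>(2) I_def using int[OF \<phi>(1)] int[OF \<psi>(1)]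
      by (simp add: scaleR_add_left flip: scaleR_scaleR)
    ultimately show "a *\<^sub>R x + b *\<^sub>R y \<in> I ` F" by blast
  qed
  moreover have "bounded (I ` F)"
    unfolding bounded_iff
  proof (intro exI ballI)
    fix x assume "x \<in> I ` F"
    then obtain \<phi> where \<phi>: "\<phi> \<in> F" "x = I \<phi>" by blast
    have "norm x \<le> integral\<^sup>L \<mu> (\<lambda>v. norm (\<phi> v *\<^sub>R v))"
      unfolding \<phi>(2) I_def by (rule integral_norm_bound)
    also have "\<dots> \<le> integral\<^sup>L \<mu> (\<lambda>v. 1)"
      using int[OF \<phi>(1)] \<phi>(1) by (intro integral_mono integrable_norm) (auto simp: F_def space_eq)
    finally show "norm x \<le> measure \<mu> (space \<mu>)" by simp
  qed
  moreover have "(\<lambda>v. 0) \<in> F" by (simp add: F_def)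
  ultimately have "Z \<in> convex_bodies"
    unfolding Z_def convex_bodies_def by (auto simp: convex_closure)
  then show ?thesis using supp that by blast
qed

end

section \<open>Signed measures\<close>

lemma signed_measure_disjoint_Un:
  assumes \<rho>: "signed_measure M \<rho>" and "A \<in> sets M" "B \<in> sets M" "A \<inter> B = {}"
  shows "\<rho> (A \<union> B) = \<rho> A + \<rho> B"
proof -
  have "range (binaryset A B) \<subseteq> sets M" "disjoint_family (binaryset A B)"
    using assms by (auto simp: binaryset_def disjoint_family_on_def)
  then have "(\<lambda>i. \<rho> (binaryset A B i)) sums \<rho> (\<Union>i. binaryset A B i)"
    using \<rho> by (simp add: signed_measure_def)
  moreover have "(\<lambda>i. \<rho> (binaryset A B i)) sums (\<rho> A + \<rho> B)"
    using \<rho> by (intro binaryset_sums) (simp add: signed_measure_def)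
  ultimately show ?thesis by (simp add: sums_unique2 UN_binaryset_eq)
qed

text \<open>If a signed measure is unbounded on the subsets of \<open>E\<close>, then \<open>E\<close> splits into a part of mass
  larger than \<open>1\<close> in absolute value and a part on whose subsets the measure is still unbounded.
  Iterating gives disjoint sets whose masses do not tend to \<open>0\<close>.\<close>

lemma signed_measure_bounded:
  assumes \<rho>: "signed_measure M \<rho>"
  obtains C where "\<And>B. B \<in> sets M \<Longrightarrow> \<bar>\<rho> B\<bar> \<le> C"
proof (rule ccontr)
  assume "\<not> thesis"
  define big where "big E \<longleftrightarrow> E \<in> sets M \<and> (\<forall>C. \<exists>B\<in>sets M. B \<subseteq> E \<and> C < \<bar>\<rho> B\<bar>)" for E
  have big_space: "big (space M)"
    unfolding big_def using \<open>\<not> thesis\<close> that sets.sets_into_space by (metis linorder_not_le sets.top)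
  have split: "\<exists>F. big F \<and> F \<subseteq> E \<and> 1 < \<bar>\<rho> (E - F)\<bar>" if E: "big E" for E
  proof -
    \<comment> \<open>Exceeding 1 + |\<rho> E| forces both \<open>B\<close> and \<open>E - B\<close>
      to have mass above 1 in absolute value, so either of them may be split off.\<close>
    obtain B where B: "B \<in> sets M" "B \<subseteq> E" "1 + \<bar>\<rho> E\<bar> < \<bar>\<rho> B\<bar>"
      using E unfolding big_def by blast
    have E': "E \<in> sets M" using E by (simp add: big_def)
    have "\<rho> E = \<rho> B + \<rho> (E - B)"
      using signed_measure_disjoint_Un[OF \<rho>, of B "E - B"] B E' by (simp add: Un_absorb1)
    then have *: "1 < \<bar>\<rho> B\<bar>" "1 < \<bar>\<rho> (E - B)\<bar>" using B(3) by linarith+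
    have "big B \<or> big (E - B)"
    proof (rule ccontr)
      assume "\<not> ?thesis"
      then obtain C1 C2 where C: "\<And>X. X \<in> sets M \<Longrightarrow> X \<subseteq> B \<Longrightarrow> \<bar>\<rho> X\<bar> \<le> C1"
        "\<And>X. X \<in> sets M \<Longrightarrow> X \<subseteq> E - B \<Longrightarrow> \<bar>\<rho> X\<bar> \<le> C2"
        unfolding big_def using B(1) E' by (metis linorder_not_le sets.Diff)
      have "\<bar>\<rho> X\<bar> \<le> C1 + C2" if X: "X \<in> sets M" "X \<subseteq> E" for X
      proof -
        have "\<rho> X = \<rho> (X \<inter> B) + \<rho> (X - B)"
          using signed_measure_disjoint_Un[OF \<rho>, of "X \<inter> B" "X - B"] X B by (simp add: Int_Diff_Un Int_Diff_disjoint)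
        then show ?thesis using C(1)[of "X \<inter> B"] C(2)[of "X - B"] X B by fastforce
      qed
      then show False using E unfolding big_def by (metis linorder_not_le)
    qed
    then show ?thesis
    proof
      assume "big B" then show ?thesis using B *(2) by blast
    next
      assume "big (E - B)"
      moreover have "E - (E - B) = B" using B by auto
      ultimately show ?thesis using *(1) by (metis Diff_subset)
    qed
  qed
  have "\<exists>F. \<forall>n. big (F n) \<and> (F (Suc n) \<subseteq> F n \<and> 1 < \<bar>\<rho> (F n - F (Suc n))\<bar>)"
    by (rule dependent_nat_choice) (use big_space split in blast)+
  then obtain F where F: "\<And>n. big (F n)" "\<And>n. F (Suc n) \<subseteq> F n" "\<And>n. 1 < \<bar>\<rho> (F n - F (Suc n))\<bar>"
    by blast
  define D where "D n = F n - F (Suc n)" for n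
  have anti: "F n \<subseteq> F m" if "m \<le> n" for m n
    using that F(2) by (intro decseqD[of F]) (auto simp: decseq_Suc_iff)
  have "disjoint_family D"
    unfolding disjoint_family_on_def
  proof (intro ballI impI)
    fix m n :: nat assume "m \<noteq> n"
    then show "D m \<inter> D n = {}"
      using anti[of "Suc m" n] anti[of "Suc n" m] unfolding D_def by (cases "m < n") auto
  qed
  moreover have "range D \<subseteq> sets M" using F(1) by (auto simp: D_def big_def)
  ultimately have "(\<lambda>n. \<rho> (D n)) sums \<rho> (\<Union>n. D n)" using \<rho> by (simp add: signed_measure_def)
  then have "(\<lambda>n. \<rho> (D n)) \<longlonglongrightarrow> 0" by (intro summable_LIMSEQ_zero sums_summable)
  then obtain n where "\<bar>\<rho> (D n)\<bar> < 1"
    using LIMSEQ_D[of "\<lambda>n. \<rho> (D n)" 0 1] by auto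
  then show False using F(3)[of n] by (simp add: D_def)
qed

lemma signed_measure_uminus:
  "signed_measure M \<rho> \<Longrightarrow> signed_measure M (\<lambda>A. - \<rho> A)"
  by (auto simp: signed_measure_def intro: sums_minus)

text \<open>A bound for |\<rho>| passes to the supremum. The measure built by
  \<open>measure_of\<close> takes either this supremum or 0 as its values, and the bound covers both
  cases.\<close>

lemma finite_sphere_measure_positive_variation:
  assumes "signed_measure sphere_borel \<rho>"
  shows "finite_sphere_measure (positive_variation (sphere_borel :: 'a::euclidean_space measure) \<rho>)"
proof -
  let ?M = "sphere_borel :: 'a measure"
  let ?\<mu> = "\<lambda>A. SUP B\<in>{B \<in> sets ?M. B \<subseteq> A}. ennreal (\<rho> B)"
  obtain C where C: "\<And>B. B \<in> sets ?M \<Longrightarrow> \<bar>\<rho> B\<bar> \<le> C" using signed_measure_bounded[OF assms] by blast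
  have le: "?\<mu> A \<le> ennreal C" for A
  proof (rule SUP_least)
    fix B assume "B \<in> {B \<in> sets ?M. B \<subseteq> A}"
    then show "ennreal (\<rho> B) \<le> ennreal C" using C[of B] by (intro ennreal_leI) simp
  qed
  have "emeasure (positive_variation ?M \<rho>) A \<le> ennreal C" for A
    unfolding positive_variation_def emeasure_measure_of_conv using le by simp
  then have "emeasure (positive_variation ?M \<rho>) A \<noteq> \<infinity>" for A
    using ennreal_less_top[of C] by (metis infinity_ennreal_def leD)
  moreover have "sets (positive_variation ?M \<rho>) = sets ?M"
    unfolding positive_variation_def by (rule sets.sets_measure_of_eq)
  ultimately show ?thesis
    by (intro finite_sphere_measure.intro finite_measureI finite_sphere_measure_axioms.intro)
qed

section \<open>Operators satisfying the volume condition\<close>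

lemma sym_segment_eq_iff: "sym_segment a = sym_segment b \<longleftrightarrow> a = b \<or> a = - b"
  for a b :: "'a::euclidean_space"
  by (auto simp: sym_segment_def closed_segment_eq doubleton_eq_iff)

text \<open>The two sides are the support functions of the segments of \<open>a\<close> and
  \<open>b\<close>, and a segment determines its endpoints. It recovers vectors that are accessible
  only up to sign.\<close>

lemma eq_or_uminus_if_abs_inner_eq:
  fixes a b :: "'a::euclidean_space"
  assumes "\<And>u. \<bar>u \<bullet> a\<bar> = \<bar>u \<bullet> b\<bar>"
  shows "a = b \<or> a = - b"
  using convex_bodies_eqI[of "sym_segment a" "sym_segment b"] assms sym_segment_eq_iff[of a b] by simp

lemma sym_segment_subset_scaleR:
  "\<bar>s\<bar> \<le> \<bar>t\<bar> \<Longrightarrow> sym_segment (s *\<^sub>R v) \<subseteq> sym_segment (t *\<^sub>R (v :: 'a::euclidean_space))"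
  by (intro subset_if_support_function_le) (auto simp: convex_bodiesD abs_mult mult_right_mono)

lemma min_norm_diff_add_scaleR:
  fixes a b :: "'a::real_normed_vector"
  assumes "0 \<le> s"
  shows "min (norm (s *\<^sub>R a - s *\<^sub>R b)) (norm (s *\<^sub>R a + s *\<^sub>R b)) = s * min (norm (a - b)) (norm (a + b))"
  using assms by (simp add: min_mult_distrib_left flip: scaleR_right_diff_distrib scaleR_add_right)

text \<open>In Cauchy's functional equation, nonnegativity gives monotonicity, which takes the place
  of continuity: squeezing n t between consecutive integers leaves an error of at most f 1 /
  n.\<close>

lemma additive_nonneg_imp_linear:
  fixes f :: "real \<Rightarrow> real"
  assumes add: "\<And>s t. 0 \<le> s \<Longrightarrow> 0 \<le> t \<Longrightarrow> f (s + t) = f s + f t"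
    and nonneg: "\<And>t. 0 \<le> t \<Longrightarrow> 0 \<le> f t" and "0 \<le> t"
  shows "f t = t * f 1"
proof -
  have mono: "f s \<le> f t" if "0 \<le> s" "s \<le> t" for s t
    using add[of s "t - s"] nonneg[of "t - s"] that by simp
  have mult: "f (real n * s) = real n * f s" if "0 \<le> s" for n s
  proof (induction n)
    case 0 show ?case using add[of 0 0] by simp
  next
    case (Suc n) then show ?case using add[of s "real n * s"] that by (simp add: algebra_simps)
  qed
  have bound: "real n * \<bar>f t - t * f 1\<bar> \<le> f 1" for n
  proof -
    define k where "k = nat \<lfloor>real n * t\<rfloor>"
    have k: "real k \<le> real n * t" "real n * t \<le> real (Suc k)"
      unfolding k_def using \<open>0 \<le> t\<close> by auto linarith
    have "real k * f 1 \<le> real n * f t" "real n * f t \<le> real (Suc k) * f 1"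
      using mono[OF _ k(1)] mono[OF _ k(2)] mult[of 1 k] mult[of 1 "Suc k"] mult[of t n] \<open>0 \<le> t\<close> by auto
    moreover have "real k * f 1 \<le> real n * t * f 1" "real n * t * f 1 \<le> real (Suc k) * f 1"
      using k nonneg[of 1] by (auto intro: mult_right_mono)
    moreover have "real (Suc k) * f 1 = real k * f 1 + f 1" by (simp add: algebra_simps)
    ultimately have "\<bar>real n * f t - real n * t * f 1\<bar> \<le> f 1" by linarith
    moreover have "real n * f t - real n * t * f 1 = real n * (f t - t * f 1)" by (simp add: algebra_simps)
    ultimately show ?thesis by (simp add: abs_mult)
  qed
  have "\<not> 0 < \<bar>f t - t * f 1\<bar>"
  proof
    assume "0 < \<bar>f t - t * f 1\<bar>"
    then obtain n where "f 1 < real n * \<bar>f t - t * f 1\<bar>" using reals_Archimedean3 by blast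
    then show False using bound[of n] by simp
  qed
  then show ?thesis by simp
qed

text \<open>Since 0 lies in every summand, each summand is a subset of the sum.\<close>

lemma span_set_sum:
  fixes K :: "'i \<Rightarrow> 'a::euclidean_space set"
  assumes "finite A" "\<And>i. i \<in> A \<Longrightarrow> 0 \<in> K i"
  shows "span (\<Sum>i\<in>A. K i) = span (\<Union>i\<in>A. K i)"
proof (rule subset_antisym)
  have "(\<Sum>i\<in>A. K i) \<subseteq> span (\<Union>i\<in>A. K i)"
  proof
    fix x assume "x \<in> (\<Sum>i\<in>A. K i)"
    then obtain f where f: "x = sum f A" "\<And>i. i \<in> A \<Longrightarrow> f i \<in> K i" by (rule mem_set_sumE[OF _ assms(1)]) blast
    show "x \<in> span (\<Union>i\<in>A. K i)" unfolding f(1) by (intro span_sum span_base) (use f(2) in blast)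
  qed
  then show "span (\<Sum>i\<in>A. K i) \<subseteq> span (\<Union>i\<in>A. K i)" by (simp add: span_minimal)
  have "K i \<subseteq> (\<Sum>i\<in>A. K i)" if i: "i \<in> A" for i
  proof
    fix x assume x: "x \<in> K i"
    have "(\<Sum>j\<in>A. if j = i then x else 0) \<in> (\<Sum>i\<in>A. K i)"
      using assms(2) x by (intro sum_mem_set_sum) auto
    then show "x \<in> (\<Sum>i\<in>A. K i)" using i assms(1) by simp
  qed
  then show "span (\<Union>i\<in>A. K i) \<subseteq> span (\<Sum>i\<in>A. K i)" by (intro span_mono) blast
qed

lemma zero_mem_set_sum:
  assumes "\<And>i. i \<in> A \<Longrightarrow> (0 :: 'a::comm_monoid_add) \<in> K i" shows "0 \<in> (\<Sum>i\<in>A. K i)"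
  using sum_mem_set_sum[of A "\<lambda>_. 0" K] assms by simp

section \<open>Images of segments are segments\<close>

locale volume_comparable_operator =
  fixes \<Phi> :: "'a::euclidean_space set \<Rightarrow> 'a set"
  assumes dim_ge_2: "2 \<le> DIM('a)" and MAdd: "\<Phi> \<in> MAdd_sym" and vc: "volume_condition \<Phi>"
begin

lemma convex_body [simp]: "K \<in> convex_bodies \<Longrightarrow> \<Phi> K \<in> convex_bodies"
  using MAdd by (auto simp: MAdd_sym_def)

lemma plus: "K \<in> convex_bodies \<Longrightarrow> L \<in> convex_bodies \<Longrightarrow> \<Phi> (K + L) = \<Phi> K + \<Phi> L"
  using MAdd by (auto simp: MAdd_sym_def)

lemma translation: "K \<in> convex_bodies \<Longrightarrow> \<Phi> ((\<lambda>x. x + t) ` K) = \<Phi> K"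
  using MAdd by (auto simp: MAdd_sym_def)

lemma continuous: "continuous_wrt convex_bodies hausdorff_distance hausdorff_distance \<Phi>"
  using MAdd by (simp add: MAdd_sym_def)

lemma zero_mem:
  assumes "K \<in> convex_bodies" shows "0 \<in> \<Phi> K"
proof -
  obtain x where x: "x \<in> \<Phi> K" using assms convex_bodiesD(1)[OF convex_body] by blast
  have "\<Phi> K = uminus ` \<Phi> K" using MAdd assms by (auto simp: MAdd_sym_def)
  then have "- x \<in> \<Phi> K" using x by blast
  then have "(1/2) *\<^sub>R x + (1/2) *\<^sub>R (- x) \<in> \<Phi> K"
    using x convex_bodiesD(3)[OF convex_body[OF assms]] by (intro convexD) auto
  then show ?thesis by simp
qed

text \<open>By additivity the support function of the image equals twice itself.\<close>

lemma singleton_0: "\<Phi> {0} = {0}"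
proof (rule convex_bodies_eqI)
  fix u
  have "\<Phi> {0} = \<Phi> {0} + \<Phi> {0}" using plus[of "{0}" "{0}"] by simp
  then have "support_function (\<Phi> {0}) u = support_function (\<Phi> {0} + \<Phi> {0}) u" by simp
  then show "support_function (\<Phi> {0}) u = support_function {0} u" by (simp add: support_function_plus)
qed auto

lemma sum:
  assumes "\<And>i. i \<in> A \<Longrightarrow> K i \<in> convex_bodies"
  shows "\<Phi> (\<Sum>i\<in>A. K i) = (\<Sum>i\<in>A. \<Phi> (K i))"
  using assms
  by (induction A rule: infinite_finite_induct) (auto simp: singleton_0 plus sum_in_convex_bodies)

text \<open>What is extracted from the volume condition here is that a body and its image are null
  together.\<close>

lemma span_UNIV_iff:
  assumes "K \<in> convex_bodies" "0 \<in> K"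
  shows "span (\<Phi> K) = UNIV \<longleftrightarrow> span K = UNIV"
proof -
  obtain c C where "0 < c" "0 < C" and cC: "c * measure lebesgue K \<le> measure lebesgue (\<Phi> K)"
    "measure lebesgue (\<Phi> K) \<le> C * measure lebesgue K"
    using vc assms(1) unfolding volume_condition_def by blast
  have "0 < measure lebesgue (\<Phi> K) \<longleftrightarrow> 0 < measure lebesgue K"
  proof
    assume "0 < measure lebesgue (\<Phi> K)"
    then have "0 < C * measure lebesgue K" using cC by linarith
    then show "0 < measure lebesgue K" using \<open>0 < C\<close> by (simp add: zero_less_mult_iff)
  next
    assume "0 < measure lebesgue K"
    then have "0 < c * measure lebesgue K" using \<open>0 < c\<close> by simp
    then show "0 < measure lebesgue (\<Phi> K)" using cC by linarith
  qed
  then show ?thesis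
    using measure_pos_iff_span_UNIV[of K] measure_pos_iff_span_UNIV[of "\<Phi> K"] assms zero_mem
      convex_bodiesD[OF assms(1)] convex_bodiesD[OF convex_body[OF assms(1)]] by blast
qed

text \<open>Extend \<open>v\<close> to a basis \<open>B\<close>. Each of the n - 1 other basis
  vectors must add at least one dimension to the span of the images, so at most one is left for the
  image belonging to \<open>v\<close>. That image has to add a dimension as well, so exactly one
  remains.\<close>

lemma dim_segment:
  assumes "v \<noteq> 0" shows "dim (\<Phi> (sym_segment v)) = 1"
proof -
  obtain B where B: "{v} \<subseteq> B" "B \<subseteq> UNIV" "independent B" "UNIV \<subseteq> span B"
    using maximal_independent_subset_extend[of "{v}" UNIV] assms by auto
  have fin: "finite B" using B(3) by (rule independent_imp_finite)
  have card: "card B = DIM('a)" using B dim_unique[of B UNIV] by auto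
  define L where "L b = \<Phi> (sym_segment b)" for b
  define S where "S A = span (\<Union>b\<in>A. L b)" for A
  have mono: "S A \<subseteq> S A'" if "A \<subseteq> A'" for A A' unfolding S_def using that by (intro span_mono) auto
  have seg0: "0 \<in> sym_segment b" for b :: 'a unfolding mem_sym_segment by (intro exI[of _ 0]) simp
  have S_UNIV: "S A = UNIV \<longleftrightarrow> span A = UNIV" if "finite A" for A
  proof -
    have *: "span (\<Sum>b\<in>A. sym_segment b) = span A"
      unfolding span_set_sum[OF that seg0]
    proof (rule subset_antisym)
      have "b \<in> sym_segment b" for b :: 'a by (simp add: sym_segment_def)
      then show "span A \<subseteq> span (\<Union>b\<in>A. sym_segment b)" by (intro span_mono) blast
      have "sym_segment b \<subseteq> span A" if "b \<in> A" for b
        using that by (auto simp: mem_sym_segment intro!: span_scale[OF span_base])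
      then show "span (\<Union>b\<in>A. sym_segment b) \<subseteq> span A" by (intro span_minimal) auto
    qed
    have "S A = span (\<Sum>b\<in>A. L b)"
      unfolding S_def L_def using that by (intro span_set_sum[symmetric]) (auto intro: zero_mem)
    also have "(\<Sum>b\<in>A. L b) = \<Phi> (\<Sum>b\<in>A. sym_segment b)" unfolding L_def by (rule sum[symmetric]) auto
    finally show ?thesis
      using span_UNIV_iff[of "\<Sum>b\<in>A. sym_segment b"] zero_mem_set_sum[of A sym_segment, OF seg0] *
      by (simp add: sum_in_convex_bodies)
  qed
  \<comment> \<open>Otherwise the images for \<open>B - {b}\<close> would already span the space,
    hence so would \<open>B - {b}\<close>, against independence.\<close>
  have not_sub: "\<not> L b \<subseteq> S (B - {b})" if b: "b \<in> B" for b
  proof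
    assume "L b \<subseteq> S (B - {b})"
    then have "(\<Union>b\<in>B. L b) \<subseteq> S (B - {b})" unfolding S_def by (auto intro: span_base)
    then have "S B \<subseteq> S (B - {b})" unfolding S_def by (intro span_minimal) auto
    then have "span (B - {b}) = UNIV" using S_UNIV[of B] S_UNIV[of "B - {b}"] fin B(4) by auto
    then have "b \<in> span (B - {b})" by simp
    then show False using B(3) b unfolding dependent_def by blast
  qed
  have step: "dim (L v) + card A \<le> dim (S (insert v A))" if "finite A" "A \<subseteq> B - {v}" for A
    using that
  proof (induction A rule: finite_induct)
    case empty
    show ?case by (simp add: S_def)
  next
    case (insert b A)
    obtain y where y: "y \<in> L b" "y \<notin> S (B - {b})" using not_sub[of b] insert.prems by blast
    \<comment> \<open>As \<open>b\<close> is neither \<open>v\<close> nor in \<open>A\<close>, the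
      vector \<open>y\<close> lies outside the span built so far and raises its dimension.\<close>
    have "S (insert v A) \<subseteq> S (B - {b})" using insert.prems insert.hyps B(1) by (intro mono) auto
    then have "y \<notin> span (S (insert v A))" using y by (auto simp: S_def span_span)
    then have "dim (insert y (S (insert v A))) = dim (S (insert v A)) + 1" by (simp add: dim_insert)
    moreover have "insert y (S (insert v A)) \<subseteq> S (insert v (insert b A))"
      using y(1) mono[of "insert v A" "insert v (insert b A)"] by (auto simp: S_def intro: span_base)
    then have "dim (insert y (S (insert v A))) \<le> dim (S (insert v (insert b A)))" by (rule dim_subset)
    ultimately show ?case using insert by simp
  qed
  have "dim (L v) + card (B - {v}) \<le> dim (S (insert v (B - {v})))" using fin by (intro step) auto
  also have "\<dots> \<le> DIM('a)" by (rule dim_subset_UNIV)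
  finally have "dim (L v) \<le> 1" using card B(1) fin by (simp add: card_Diff_singleton)
  moreover have "dim (L v) \<noteq> 0"
    using not_sub[of v] B(1) span_0 unfolding S_def by (auto simp: dim_eq_0)
  ultimately have "dim (L v) = 1" by linarith
  then show ?thesis by (simp add: L_def)
qed

text \<open>A one-dimensional convex body that is symmetric about 0 is the segment of its longest
  vector. Treating v = 0 along with the rest lets \<open>g\<close> be defined everywhere.\<close>

lemma segment_exists: "\<exists>x. \<Phi> (sym_segment v) = sym_segment x \<and> (x = 0 \<longleftrightarrow> v = 0)"
proof (cases "v = 0")
  case True then show ?thesis using singleton_0 by (intro exI[of _ 0]) simp
next
  case False
  define L where "L = \<Phi> (sym_segment v)"
  have "L \<in> convex_bodies" by (simp add: L_def)
  note L = convex_bodiesD[OF this]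
  have dim: "dim L = 1" using dim_segment[OF False] by (simp add: L_def)
  obtain x where x: "x \<in> L" "\<And>y. y \<in> L \<Longrightarrow> norm y \<le> norm x"
    using continuous_attains_sup[OF L(2,1), of norm] by (auto intro: continuous_on_norm_id)
  have "x \<noteq> 0"
  proof
    assume "x = 0"
    then have "L \<subseteq> {0}" using x(2) by fastforce
    then show False using dim by (simp flip: dim_eq_0)
  qed
  have "L = uminus ` L" using MAdd by (auto simp: MAdd_sym_def L_def)
  then have "- x \<in> L" using x(1) by blast
  have "L = sym_segment x"
  proof (rule subset_antisym)
    show "sym_segment x \<subseteq> L" 
      unfolding sym_segment_def using \<open>- x \<in> L\<close> x(1) L(3) by (rule closed_segment_subset)
    have "L \<subseteq> span {x}" using x(1) \<open>x \<noteq> 0\<close> dim by (intro card_ge_dim_independent) auto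
    show "L \<subseteq> sym_segment x"
    proof
      fix y assume y: "y \<in> L"
      then obtain t where t: "y = t *\<^sub>R x" using \<open>L \<subseteq> span {x}\<close> by (auto simp: span_singleton)
      then have "\<bar>t\<bar> * norm x \<le> 1 * norm x" using x(2)[OF y] by simp
      then have "\<bar>t\<bar> \<le> 1" using \<open>x \<noteq> 0\<close> by (subst (asm) mult_le_cancel_right_pos) auto
      then show "y \<in> sym_segment x" using t unfolding mem_sym_segment by blast
    qed
  qed
  then show ?thesis using \<open>x \<noteq> 0\<close> False by (auto simp: L_def)
qed

text \<open>One of the two endpoints of the image segment, selected without regard to continuity;
  its sign is arbitrary at every \<open>v\<close>.\<close>

definition g :: "'a \<Rightarrow> 'a" where
  "g v = (SOME x. \<Phi> (sym_segment v) = sym_segment x \<and> (x = 0 \<longleftrightarrow> v = 0))"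

lemma Phi_segment: "\<Phi> (sym_segment v) = sym_segment (g v)"
  and g_eq_0_iff [simp]: "g v = 0 \<longleftrightarrow> v = 0"
  using someI_ex[OF segment_exists[of v]] unfolding g_def by auto

section \<open>Homogeneity and continuity of \<open>g\<close> up to sign\<close>

lemma abs_inner_g: "\<bar>u \<bullet> g v\<bar> = support_function (\<Phi> (sym_segment v)) u"
  by (simp add: Phi_segment)

text \<open>Segments add along a ray, so |u \<bullet> g (t v)| is additive and nonnegative in t
  \<ge> 0, hence linear. A negative factor gives the same segment as its absolute value.\<close>

lemma abs_inner_g_scaleR: "\<bar>u \<bullet> g (t *\<^sub>R v)\<bar> = \<bar>t\<bar> * \<bar>u \<bullet> g v\<bar>"
proof -
  have pos: "\<bar>u \<bullet> g (t *\<^sub>R v)\<bar> = t * \<bar>u \<bullet> g (1 *\<^sub>R v)\<bar>" if "0 \<le> t" for t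
  proof (rule additive_nonneg_imp_linear[of "\<lambda>t. \<bar>u \<bullet> g (t *\<^sub>R v)\<bar>"])
    fix s t :: real assume "0 \<le> s" "0 \<le> t"
    then have "sym_segment ((s + t) *\<^sub>R v) = sym_segment (s *\<^sub>R v) + sym_segment (t *\<^sub>R v)"
      by (intro convex_bodies_eqI)
        (auto simp: support_function_plus abs_mult distrib_right[of s t "\<bar>_ \<bullet> v\<bar>"] simp del: scaleR_left_distrib)
    then have "\<Phi> (sym_segment ((s + t) *\<^sub>R v)) = \<Phi> (sym_segment (s *\<^sub>R v)) + \<Phi> (sym_segment (t *\<^sub>R v))"
      by (simp add: plus)
    then show "\<bar>u \<bullet> g ((s + t) *\<^sub>R v)\<bar> = \<bar>u \<bullet> g (s *\<^sub>R v)\<bar> + \<bar>u \<bullet> g (t *\<^sub>R v)\<bar>"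
      unfolding abs_inner_g by (simp add: support_function_plus)
  qed (use that in auto)
  have "sym_segment (t *\<^sub>R v) = sym_segment (\<bar>t\<bar> *\<^sub>R v)"
    by (intro convex_bodies_eqI) (auto simp: abs_mult)
  then have "\<bar>u \<bullet> g (t *\<^sub>R v)\<bar> = \<bar>u \<bullet> g (\<bar>t\<bar> *\<^sub>R v)\<bar>" unfolding abs_inner_g by (rule arg_cong)
  then show ?thesis using pos[of "\<bar>t\<bar>"] by simp
qed

lemma g_scaleR: "g (t *\<^sub>R v) = t *\<^sub>R g v \<or> g (t *\<^sub>R v) = - (t *\<^sub>R g v)"
  by (intro eq_or_uminus_if_abs_inner_eq) (simp add: abs_inner_g_scaleR abs_mult)

lemma norm_g_scaleR: "norm (g (t *\<^sub>R v)) = \<bar>t\<bar> * norm (g v)"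
  using g_scaleR[of t v] by auto

lemma g_uminus: "g (- v) = g v \<or> g (- v) = - g v"
  using g_scaleR[of "- 1" v] by auto

lemma sym_segment_g_scaleR: "sym_segment (g (t *\<^sub>R v)) = sym_segment (t *\<^sub>R g v)"
  using g_scaleR[of t v] by (auto simp only: sym_segment_uminus)

text \<open>The segment of \<open>v\<close> depends on \<open>v\<close> in a 1-Lipschitz way, so
  continuity is inherited from \<Phi>.\<close>

lemma continuous_abs_inner_g: "continuous_on S (\<lambda>v. \<bar>u \<bullet> g v\<bar>)"
proof (rule continuous_on_subset[OF _ subset_UNIV])
  show "continuous_on UNIV (\<lambda>v. \<bar>u \<bullet> g v\<bar>)"
    unfolding continuous_on_iff
  proof (intro ballI allI impI)
    fix v :: 'a and \<epsilon> :: real assume "0 < \<epsilon>"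
    \<comment> \<open>The added 1 allows for u = 0.\<close>
    define \<epsilon>' where "\<epsilon>' = \<epsilon> / (norm u + 1)"
    have "0 < norm u + 1" by (simp add: add_nonneg_pos)
    then have \<epsilon>': "0 < \<epsilon>'" using \<open>0 < \<epsilon>\<close> by (simp add: \<epsilon>'_def)
    obtain \<delta> where \<delta>: "0 < \<delta>" "\<And>L. L \<in> convex_bodies \<Longrightarrow> hausdorff_distance (sym_segment v) L < \<delta> \<Longrightarrow>
        hausdorff_distance (\<Phi> (sym_segment v)) (\<Phi> L) < \<epsilon>'"
      using continuous \<epsilon>' unfolding continuous_wrt_def by (meson sym_segment_in_convex_bodies)
    show "\<exists>d>0. \<forall>x'\<in>UNIV. dist x' v < d \<longrightarrow> dist \<bar>u \<bullet> g x'\<bar> \<bar>u \<bullet> g v\<bar> < \<epsilon>"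
    proof (intro exI[of _ \<delta>] conjI ballI impI \<delta>(1))
      fix w assume w: "dist w v < \<delta>"
      have "hausdorff_distance (sym_segment v) (sym_segment w) \<le> dist w v"
      proof (rule hausdorff_distance_le)
        fix e :: 'a assume "norm e = 1"
        then have "\<bar>e \<bullet> (v - w)\<bar> \<le> dist w v"
          using Cauchy_Schwarz_ineq2[of e "v - w"] by (simp add: dist_norm norm_minus_commute)
        then show "\<bar>support_function (sym_segment v) e - support_function (sym_segment w) e\<bar> \<le> dist w v"
          by (auto simp: inner_diff_right)
      qed auto
      then have "hausdorff_distance (\<Phi> (sym_segment v)) (\<Phi> (sym_segment w)) < \<epsilon>'"
        using w by (intro \<delta>(2)) auto
      then have "norm u * hausdorff_distance (\<Phi> (sym_segment v)) (\<Phi> (sym_segment w)) \<le> norm u * \<epsilon>'"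
        by (intro mult_left_mono) auto
      also have "\<dots> < (norm u + 1) * \<epsilon>'" using \<epsilon>' by simp
      also have "\<dots> = \<epsilon>" using \<open>0 < norm u + 1\<close> by (simp add: \<epsilon>'_def)
      finally have "norm u * hausdorff_distance (\<Phi> (sym_segment v)) (\<Phi> (sym_segment w)) < \<epsilon>" .
      then show "dist \<bar>u \<bullet> g w\<bar> \<bar>u \<bullet> g v\<bar> < \<epsilon>"
        using support_function_diff_le[of "\<Phi> (sym_segment v)" "\<Phi> (sym_segment w)" u]
        unfolding abs_inner_g dist_real_def by simp
    qed
  qed
qed

text \<open>Polarization: although the sign of \<open>g v\<close> is arbitrary, its quadratic expressions are continuous.\<close>

lemma continuous_inner_g_mult: "continuous_on S (\<lambda>v. (u \<bullet> g v) * (w \<bullet> g v))"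
proof -
  have "(u \<bullet> g v) * (w \<bullet> g v) = (\<bar>(u + w) \<bullet> g v\<bar>\<^sup>2 - \<bar>(u - w) \<bullet> g v\<bar>\<^sup>2) / 4" for v
    unfolding power2_abs by (simp add: inner_add_left inner_diff_left power2_eq_square algebra_simps)
  then show ?thesis by (simp only:) (intro continuous_intros continuous_abs_inner_g, simp)
qed

lemma continuous_norm_g: "continuous_on S (\<lambda>v. norm (g v))"
proof -
  have "norm (g v) = sqrt (\<Sum>b\<in>Basis. \<bar>b \<bullet> g v\<bar>\<^sup>2)" for v
    unfolding power2_abs norm_eq_sqrt_inner[of "g v"] euclidean_inner[of "g v" "g v"]
    by (simp add: power2_eq_square inner_commute)
  then show ?thesis by (simp only:) (intro continuous_intros continuous_abs_inner_g)
qed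

text \<open>Compactness of the sphere and homogeneity; the lower constant is positive because
  \<open>g\<close> vanishes only at 0.\<close>

lemma norm_g_bounds:
  obtains m M where "0 < m" "0 < M" "\<And>v. m * norm v \<le> norm (g v)" "\<And>v. norm (g v) \<le> M * norm v"
proof -
  have ne: "sphere (0::'a) 1 \<noteq> {}" by simp
  obtain a where a: "norm a = 1" "\<And>v. norm v = 1 \<Longrightarrow> norm (g a) \<le> norm (g v)"
    using continuous_attains_inf[OF compact_sphere ne continuous_norm_g] by auto
  obtain b where b: "norm b = 1" "\<And>v. norm v = 1 \<Longrightarrow> norm (g v) \<le> norm (g b)"
    using continuous_attains_sup[OF compact_sphere ne continuous_norm_g] by auto
  show ?thesis
  proof (rule that)
    show "0 < norm (g a)" "0 < norm (g b)" using a b by auto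
    fix v :: 'a
    have *: "norm (g v) = norm v * norm (g (sgn v))"
      using norm_g_scaleR[of "norm v" "sgn v"] by (cases "v = 0") (simp_all add: sgn_div_norm)
    show "norm (g a) * norm v \<le> norm (g v)" "norm (g v) \<le> norm (g b) * norm v"
      unfolding * using a(2)[of "sgn v"] b(2)[of "sgn v"]
      by (cases "v = 0"; simp add: norm_sgn mult.commute mult_left_mono)+
  qed
qed

section \<open>Lipschitz bounds and surjectivity on directions\<close>

abbreviation ghat :: "'a \<Rightarrow> 'a" where
  "ghat v \<equiv> g v /\<^sub>R norm (g v)"

lemma norm_ghat: "v \<noteq> 0 \<Longrightarrow> norm (ghat v) = 1"
  by simp

text \<open>Choose edges \<open>E\<close> that make the parallelepiped on \<open>v\<close> and
  \<open>w\<close> large. Its image keeps a fixed fraction of the volume, yet lies in a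
  parallelepiped with bounded edges along \<open>ghat v\<close> and \<open>ghat w\<close>, whose
  volume is controlled by the distance of their lines.\<close>

lemma ghat_lipschitz_lower:
  obtains c where "0 < c" "\<And>v w. norm v = 1 \<Longrightarrow> norm w = 1 \<Longrightarrow>
    c * min (norm (v - w)) (norm (v + w)) \<le> min (norm (ghat v - ghat w)) (norm (ghat v + ghat w))"
proof -
  obtain m M where M: "0 < M" "\<And>v. norm (g v) \<le> M * norm v" by (rule norm_g_bounds) blast
  obtain \<kappa> where \<kappa>: "0 < \<kappa>" "\<And>v w::'a. norm v = 1 \<Longrightarrow> norm w = 1 \<Longrightarrow>
      \<exists>E. finite E \<and> card E + 2 \<le> DIM('a) \<and> (\<forall>e\<in>E. norm e = 1) \<and>
        \<kappa> * min (norm (v - w)) (norm (v + w))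
          \<le> measure lebesgue (sym_segment v + sym_segment w + (\<Sum>e\<in>E. sym_segment e))"
    by (rule sum_segments_measure_ge[OF dim_ge_2]) blast
  obtain C where C: "0 < C" "\<And>(v::'a) w E (f :: 'a \<Rightarrow> 'a). finite E \<Longrightarrow> card E + 2 \<le> DIM('a) \<Longrightarrow>
      norm v \<le> M \<Longrightarrow> norm w \<le> M \<Longrightarrow> (\<And>e. e \<in> E \<Longrightarrow> norm (f e) \<le> M) \<Longrightarrow>
      measure lebesgue (sym_segment v + sym_segment w + (\<Sum>e\<in>E. sym_segment (f e)))
        \<le> C * min (norm (v - w)) (norm (v + w))"
    by (rule sum_segments_measure_le[where M = M]) blast
  obtain c where c: "0 < c" "\<And>K. K \<in> convex_bodies \<Longrightarrow> c * measure lebesgue K \<le> measure lebesgue (\<Phi> K)"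
    using vc unfolding volume_condition_def by blast
  show ?thesis
  proof (rule that)
    show "0 < c * \<kappa> / (C * M)" using c C \<kappa> M by simp
    fix v w :: 'a assume v: "norm v = 1" and w: "norm w = 1"
    obtain E where E: "finite E" "card E + 2 \<le> DIM('a)" "\<forall>e\<in>E. norm e = 1"
      "\<kappa> * min (norm (v - w)) (norm (v + w))
          \<le> measure lebesgue (sym_segment v + sym_segment w + (\<Sum>e\<in>E. sym_segment e))"
      using \<kappa>(2)[OF v w] by blast
    define K where "K = sym_segment v + sym_segment w + (\<Sum>e\<in>E. sym_segment e)"
    \<comment> \<open>Stretching \<open>g v\<close> and \<open>g w\<close> to the common length
      \<open>M\<close> enlarges the body, and the bound then scales with the unit vectors.\<close>
    define L where "L = sym_segment (M *\<^sub>R ghat v) + sym_segment (M *\<^sub>R ghat w) + (\<Sum>e\<in>E. sym_segment (g e))"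
    have K: "K \<in> convex_bodies" unfolding K_def by (intro plus_in_convex_bodies sum_in_convex_bodies) auto
    have L: "L \<in> convex_bodies" unfolding L_def by (intro plus_in_convex_bodies sum_in_convex_bodies) auto
    have sub: "sym_segment (g x) \<subseteq> sym_segment (M *\<^sub>R ghat x)" if "norm x = 1" for x
    proof -
      have "x \<noteq> 0" using that by auto
      then have "sym_segment (norm (g x) *\<^sub>R ghat x) \<subseteq> sym_segment (M *\<^sub>R ghat x)"
        using M(1) M(2)[of x] that by (intro sym_segment_subset_scaleR) auto
      then show ?thesis using \<open>x \<noteq> 0\<close> by simp
    qed
    have "\<Phi> K = sym_segment (g v) + sym_segment (g w) + (\<Sum>e\<in>E. sym_segment (g e))"
      unfolding K_def by (simp add: plus sum plus_in_convex_bodies sum_in_convex_bodies Phi_segment)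
    also have "\<dots> \<subseteq> L" unfolding L_def by (intro set_plus_mono2 sub v w order_refl)
    finally have sub_L: "\<Phi> K \<subseteq> L" .
    have "c * (\<kappa> * min (norm (v - w)) (norm (v + w))) \<le> c * measure lebesgue K"
      using E(4) c(1) unfolding K_def by (intro mult_left_mono) auto
    also have "\<dots> \<le> measure lebesgue (\<Phi> K)" by (rule c(2)[OF K])
    also have "\<dots> \<le> measure lebesgue L"
      using sub_L K L by (intro measure_mono_fmeasurable fmeasurableD lmeasurable_compact) (auto simp: convex_bodiesD)
    also have "\<dots> \<le> C * min (norm (M *\<^sub>R ghat v - M *\<^sub>R ghat w)) (norm (M *\<^sub>R ghat v + M *\<^sub>R ghat w))"
      unfolding L_def
    proof (intro C(2) E(1,2))
      show "norm (g e) \<le> M" if "e \<in> E" for e using M(2)[of e] E(3) that by auto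
      have "v \<noteq> 0" "w \<noteq> 0" using v w by auto
      then show "norm (M *\<^sub>R ghat v) \<le> M" "norm (M *\<^sub>R ghat w) \<le> M"
        unfolding norm_scaleR[of M] norm_ghat using M(1) by auto
    qed
    also have "\<dots> = C * (M * min (norm (ghat v - ghat w)) (norm (ghat v + ghat w)))"
      using M(1) by (subst min_norm_diff_add_scaleR) auto
    finally have "c * (\<kappa> * min (norm (v - w)) (norm (v + w)))
        \<le> C * (M * min (norm (ghat v - ghat w)) (norm (ghat v + ghat w)))" .
    moreover have "c * \<kappa> / (C * M) * a \<le> b" if "c * (\<kappa> * a) \<le> C * (M * b)" for a b
      using that C(1) M(1) by (simp add: field_simps)
    ultimately show "c * \<kappa> / (C * M) * min (norm (v - w)) (norm (v + w))
        \<le> min (norm (ghat v - ghat w)) (norm (ghat v + ghat w))" by blast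
  qed
qed

text \<open>The lower Lipschitz bound identifies the directions of \<open>v\<close> and
  \<open>w\<close> up to sign, and homogeneity then recovers the lengths.\<close>

lemma g_eq_imp:
  assumes "g v = g w \<or> g v = - g w" shows "v = w \<or> v = - w"
proof (cases "v = 0 \<or> w = 0")
  case True
  then show ?thesis using assms by (metis add.inverse_neutral g_eq_0_iff neg_equal_0_iff_equal)
next
  case False
  obtain c where c: "0 < c" "\<And>v w. norm v = 1 \<Longrightarrow> norm w = 1 \<Longrightarrow>
      c * min (norm (v - w)) (norm (v + w)) \<le> min (norm (ghat v - ghat w)) (norm (ghat v + ghat w))"
    by (rule ghat_lipschitz_lower) blast
  have ghat_sgn: "ghat (sgn x) = ghat x \<or> ghat (sgn x) = - ghat x" if "x \<noteq> 0" for x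
  proof -
    have "g (sgn x) = inverse (norm x) *\<^sub>R g x \<or> g (sgn x) = - (inverse (norm x) *\<^sub>R g x)"
      unfolding sgn_div_norm by (rule g_scaleR)
    then show ?thesis using that by auto
  qed
  have "ghat v = ghat w \<or> ghat v = - ghat w" using assms by auto
  then have "ghat (sgn v) = ghat (sgn w) \<or> ghat (sgn v) = - ghat (sgn w)"
    using ghat_sgn[of v] ghat_sgn[of w] False by (metis minus_minus)
  then have "min (norm (ghat (sgn v) - ghat (sgn w))) (norm (ghat (sgn v) + ghat (sgn w))) \<le> 0"
    by (elim disjE; simp only: diff_self add.left_inverse norm_zero; simp)
  then have "c * min (norm (sgn v - sgn w)) (norm (sgn v + sgn w)) \<le> 0"
    using order_trans[OF c(2)[of "sgn v" "sgn w"]] False by (simp only: norm_sgn) simp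
  then have "min (norm (sgn v - sgn w)) (norm (sgn v + sgn w)) \<le> 0"
    using c(1) by (simp add: mult_le_0_iff)
  then have *: "sgn v = sgn w \<or> sgn v = - sgn w"
    by (auto simp: min_le_iff_disj eq_neg_iff_add_eq_0)
  have scaled: "x = norm x *\<^sub>R sgn x" "norm (g x) = norm x * norm (g (sgn x))" if "x \<noteq> 0" for x :: 'a
  proof -
    show "x = norm x *\<^sub>R sgn x" using that by (simp add: sgn_div_norm)
    then show "norm (g x) = norm x * norm (g (sgn x))" using norm_g_scaleR[of "norm x" "sgn x"] by simp
  qed
  have "norm (g (sgn v)) = norm (g (sgn w))" using * g_uminus[of "sgn w"] by auto
  moreover have "norm (g v) = norm (g w)" using assms by auto
  moreover have "sgn w \<noteq> 0" using False by (simp add: sgn_zero_iff)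
  ultimately have "norm v = norm w" using scaled(2)[of v] scaled(2)[of w] False by simp
  then show ?thesis using * scaled(1)[of v] scaled(1)[of w] False by (metis scaleR_minus_right)
qed

text \<open>Locally the sign of \<open>g\<close> can be chosen continuously, so invariance of domain shows that the
  set of all \<open>\<plusminus>g v\<close> is open; it is also closed, and \<open>- {0}\<close> is connected.\<close>

lemma g_surj:
  assumes "y \<noteq> 0" obtains v where "v \<noteq> 0" "y = g v \<or> y = - g v"
proof -
  define W where "W = {y. \<exists>v. v \<noteq> 0 \<and> (y = g v \<or> y = - g v)}"
  have W_nbhd: "\<exists>N. open N \<and> g v0 \<in> N \<and> N \<subseteq> W" if v0: "v0 \<noteq> 0" for v0
  proof -
    \<comment> \<open>The first condition excludes antipodal pairs and so makes \<open>G\<close>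
      injective; the second keeps the sign factor in \<open>G\<close> away from 0.\<close>
    define U where "U = {v. 0 < v \<bullet> v0 \<and> 0 < \<bar>g v0 \<bullet> g v\<bar>}"
    define G where "G v = sgn (g v0 \<bullet> g v) *\<^sub>R g v" for v
    have G_cases: "G v = g v \<or> G v = - g v" if "v \<in> U" for v
      using that by (auto simp: G_def U_def sgn_real_def)
    have "open U" unfolding U_def
      by (intro open_Collect_conj open_Collect_less continuous_intros continuous_abs_inner_g)
    moreover have "continuous_on U G"
    proof -
      \<comment> \<open>Each coordinate of \<open>G\<close> is a quadratic expression in
        \<open>g v\<close> over a nonvanishing absolute value, so the arbitrary sign drops
        out.\<close>
      have "G v = (\<Sum>b\<in>Basis. ((b \<bullet> g v) * (g v0 \<bullet> g v) / \<bar>g v0 \<bullet> g v\<bar>) *\<^sub>R b)" if "v \<in> U" for v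
      proof -
        have "G v = (\<Sum>b\<in>Basis. (G v \<bullet> b) *\<^sub>R b)" by (rule euclidean_representation[symmetric])
        also have "\<dots> = (\<Sum>b\<in>Basis. ((b \<bullet> g v) * (g v0 \<bullet> g v) / \<bar>g v0 \<bullet> g v\<bar>) *\<^sub>R b)"
          by (intro sum.cong refl arg_cong2[where f = scaleR])
            (simp_all add: G_def real_sgn_eq inner_commute)
        finally show ?thesis .
      qed
      moreover have "continuous_on U (\<lambda>v. \<Sum>b\<in>Basis. ((b \<bullet> g v) * (g v0 \<bullet> g v) / \<bar>g v0 \<bullet> g v\<bar>) *\<^sub>R b)"
        by (intro continuous_intros continuous_inner_g_mult continuous_abs_inner_g) (auto simp: U_def)
      ultimately show ?thesis by (simp cong: continuous_on_cong)
    qed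
    moreover have "inj_on G U"
    proof (rule inj_onI)
      fix v w assume vw: "v \<in> U" "w \<in> U" "G v = G w"
      then have "g v = g w \<or> g v = - g w" using G_cases[of v] G_cases[of w] by (metis minus_minus)
      then have "v = w \<or> v = - w" by (rule g_eq_imp)
      then show "v = w" using vw by (auto simp: U_def)
    qed
    ultimately have "open (G ` U)" by (intro invariance_of_domain)
    moreover have "v0 \<in> U" "G v0 = g v0" using v0 by (auto simp: U_def G_def sgn_real_def)
    then have "g v0 \<in> G ` U" by (metis imageI)
    moreover have "G ` U \<subseteq> W" unfolding W_def
    proof clarify
      fix v assume v: "v \<in> U"
      then have "v \<noteq> 0" by (auto simp: U_def)
      then show "\<exists>w. w \<noteq> 0 \<and> (G v = g w \<or> G v = - g w)" using G_cases[OF v] by blast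
    qed
    ultimately show ?thesis by blast
  qed
  have "open W"
  proof (subst open_subopen, intro ballI)
    fix y assume "y \<in> W"
    then obtain v where v: "v \<noteq> 0" "y = g v \<or> y = - g v" by (auto simp: W_def)
    obtain N where N: "open N" "g v \<in> N" "N \<subseteq> W" using W_nbhd[OF v(1)] by blast
    have "uminus ` W \<subseteq> W" by (auto simp: W_def)
    then have "uminus ` N \<subseteq> W" using N(3) by blast
    moreover have "open (uminus ` N)" using N(1) by (rule open_negations)
    ultimately show "\<exists>N. open N \<and> y \<in> N \<and> N \<subseteq> W" using N v(2) by (metis imageI)
  qed
  \<comment> \<open>By the lower bound on the norm of \<open>g\<close>, preimages of a convergent
    sequence stay bounded. A limit of a subsequence is a preimage of the limit up to sign; if it is
    0, so is the limit.\<close>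
  have "closed (insert 0 W)"
    unfolding closed_sequential_limits
  proof (intro allI impI)
    fix y l assume yl: "(\<forall>n. y n \<in> insert 0 W) \<and> y \<longlonglongrightarrow> l"
    have "\<exists>v. y n = g v \<or> y n = - g v" for n
    proof (cases "y n = 0")
      case True then show ?thesis by (intro exI[of _ 0]) simp
    next
      case False then show ?thesis using yl by (auto simp: W_def)
    qed
    then obtain v where v: "\<And>n. y n = g (v n) \<or> y n = - g (v n)" by metis
    obtain m M where m: "0 < m" "\<And>v. m * norm v \<le> norm (g v)" by (rule norm_g_bounds) blast
    have "Bseq y" using yl by (auto intro: convergent_imp_Bseq convergentI)
    then obtain R where R: "\<And>n. norm (y n) \<le> R" by (auto simp: Bseq_def)
    have "v n \<in> cball 0 (R / m)" for n
    proof -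
      have "norm (y n) = norm (g (v n))" using v[of n] by auto
      then have "m * norm (v n) \<le> R" using m(2)[of "v n"] R[of n] by simp
      then show ?thesis using m(1) by (simp add: field_simps)
    qed
    then obtain a r where r: "strict_mono (r :: nat \<Rightarrow> nat)" "(v \<circ> r) \<longlonglongrightarrow> a"
      using compact_cball[of "0::'a" "R / m"] unfolding compact_def by blast
    have "\<bar>u \<bullet> l\<bar> = \<bar>u \<bullet> g a\<bar>" for u
    proof (rule LIMSEQ_unique)
      have "(\<lambda>n. y (r n)) \<longlonglongrightarrow> l" using yl LIMSEQ_subseq_LIMSEQ[OF _ r(1), of y l] by (simp add: o_def)
      then show "(\<lambda>n. \<bar>u \<bullet> y (r n)\<bar>) \<longlonglongrightarrow> \<bar>u \<bullet> l\<bar>" by (intro tendsto_intros)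
      have "(\<lambda>n. \<bar>u \<bullet> g ((v \<circ> r) n)\<bar>) \<longlonglongrightarrow> \<bar>u \<bullet> g a\<bar>"
        using continuous_on_tendsto_compose[OF continuous_abs_inner_g[of UNIV u] r(2)] by simp
      moreover have "\<bar>u \<bullet> g ((v \<circ> r) n)\<bar> = \<bar>u \<bullet> y (r n)\<bar>" for n using v[of "r n"] by auto
      ultimately show "(\<lambda>n. \<bar>u \<bullet> y (r n)\<bar>) \<longlonglongrightarrow> \<bar>u \<bullet> g a\<bar>" by simp
    qed
    then have "l = g a \<or> l = - g a" by (rule eq_or_uminus_if_abs_inner_eq)
    then show "l \<in> insert 0 W" by (cases "a = 0") (auto simp: W_def)
  qed
  then have "open (- insert 0 W)" by (simp add: open_Compl)
  \<comment> \<open>Two disjoint open sets cover the punctured space, which is connected since the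
    dimension is at least 2.\<close>
  have "W \<inter> - {0} = {} \<or> - insert 0 W \<inter> - {0} = {}"
    using connectedD[OF connected_punctured_universe[OF dim_ge_2, of 0] \<open>open W\<close> \<open>open (- insert 0 W)\<close>] by auto
  moreover obtain b :: 'a where "b \<noteq> 0" using nonempty_Basis nonzero_Basis by blast
  then have "g b \<in> W \<inter> - {0}" by (auto simp: W_def)
  ultimately have "y \<in> W" using assms by blast
  then show ?thesis using that by (auto simp: W_def)
qed

text \<open>Now the edges that make the volume large are chosen next to \<open>ghat v\<close> and
  \<open>ghat w\<close> and pulled back by \<open>f\<close>, a right inverse of \<open>g\<close> up
  to sign. The preimages have norm at most 1/m, so the volume before applying \<Phi> is controlled
  by the distance of the lines of \<open>v\<close> and \<open>w\<close>.\<close>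

lemma ghat_lipschitz_upper:
  obtains C where "0 < C" "\<And>v w. norm v = 1 \<Longrightarrow> norm w = 1 \<Longrightarrow>
    min (norm (ghat v - ghat w)) (norm (ghat v + ghat w)) \<le> C * min (norm (v - w)) (norm (v + w))"
proof -
  obtain m M where m: "0 < m" "\<And>v. m * norm v \<le> norm (g v)" by (rule norm_g_bounds) blast
  obtain \<kappa> where \<kappa>: "0 < \<kappa>" "\<And>v w::'a. norm v = 1 \<Longrightarrow> norm w = 1 \<Longrightarrow>
      \<exists>E. finite E \<and> card E + 2 \<le> DIM('a) \<and> (\<forall>e\<in>E. norm e = 1) \<and>
        \<kappa> * min (norm (v - w)) (norm (v + w))
          \<le> measure lebesgue (sym_segment v + sym_segment w + (\<Sum>e\<in>E. sym_segment e))"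
    by (rule sum_segments_measure_ge[OF dim_ge_2]) blast
  obtain C where C: "0 < C" "\<And>(v::'a) w E (f :: 'a \<Rightarrow> 'a). finite E \<Longrightarrow> card E + 2 \<le> DIM('a) \<Longrightarrow>
      norm v \<le> 1 / m \<Longrightarrow> norm w \<le> 1 / m \<Longrightarrow> (\<And>e. e \<in> E \<Longrightarrow> norm (f e) \<le> 1 / m) \<Longrightarrow>
      measure lebesgue (sym_segment v + sym_segment w + (\<Sum>e\<in>E. sym_segment (f e)))
        \<le> C * min (norm (v - w)) (norm (v + w))"
    by (rule sum_segments_measure_le[where M = "1 / m"]) blast
  obtain c where c: "0 < c" "\<And>K. K \<in> convex_bodies \<Longrightarrow> measure lebesgue (\<Phi> K) \<le> c * measure lebesgue K"
    using vc unfolding volume_condition_def by blast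
  have "\<exists>x. y \<noteq> 0 \<longrightarrow> (y = g x \<or> y = - g x)" for y using g_surj[of y] by blast
  then obtain f where f: "\<And>y. y \<noteq> 0 \<Longrightarrow> y = g (f y) \<or> y = - g (f y)" by metis
  show ?thesis
  proof (rule that)
    show "0 < c * C / (m * \<kappa>)" using c C \<kappa> m by simp
    fix v w :: 'a assume v: "norm v = 1" and w: "norm w = 1"
    have "v \<noteq> 0" "w \<noteq> 0" using v w by auto
    obtain E where E: "finite E" "card E + 2 \<le> DIM('a)" "\<forall>e\<in>E. norm e = 1"
      "\<kappa> * min (norm (ghat v - ghat w)) (norm (ghat v + ghat w))
          \<le> measure lebesgue (sym_segment (ghat v) + sym_segment (ghat w) + (\<Sum>e\<in>E. sym_segment e))"
      using \<kappa>(2)[OF norm_ghat norm_ghat, OF \<open>v \<noteq> 0\<close> \<open>w \<noteq> 0\<close>] by blast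
    \<comment> \<open>Scaled so that \<open>g (n x)\<close> is \<open>ghat x\<close> up to
      sign.\<close>
    define n where "n x = x /\<^sub>R norm (g x)" for x
    define K where "K = sym_segment (n v) + sym_segment (n w) + (\<Sum>e\<in>E. sym_segment (f e))"
    define L where "L = sym_segment ((1 / m) *\<^sub>R v) + sym_segment ((1 / m) *\<^sub>R w) + (\<Sum>e\<in>E. sym_segment (f e))"
    have K: "K \<in> convex_bodies" unfolding K_def by (intro plus_in_convex_bodies sum_in_convex_bodies) auto
    have L: "L \<in> convex_bodies" unfolding L_def by (intro plus_in_convex_bodies sum_in_convex_bodies) auto
    have fE: "sym_segment (g (f e)) = sym_segment e" if "e \<in> E" for e
    proof -
      have "e \<noteq> 0" using E(3) that by auto
      then show ?thesis using f[of e] by (metis sym_segment_uminus)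
    qed
    have "\<Phi> K = sym_segment (g (n v)) + sym_segment (g (n w)) + (\<Sum>e\<in>E. sym_segment (g (f e)))"
      unfolding K_def by (simp add: plus sum plus_in_convex_bodies sum_in_convex_bodies Phi_segment)
    also have "\<dots> = sym_segment (ghat v) + sym_segment (ghat w) + (\<Sum>e\<in>E. sym_segment e)"
      using fE by (simp add: n_def sym_segment_g_scaleR)
    finally have Phi_K: "\<Phi> K = sym_segment (ghat v) + sym_segment (ghat w) + (\<Sum>e\<in>E. sym_segment e)" .
    have sub: "sym_segment (n x) \<subseteq> sym_segment ((1 / m) *\<^sub>R x)" if "norm x = 1" for x
    proof -
      have "m \<le> norm (g x)" using m(2)[of x] that by simp
      then have "inverse (norm (g x)) \<le> 1 / m" using m(1) by (simp add: divide_simps)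
      then show ?thesis unfolding n_def using m(1) by (intro sym_segment_subset_scaleR) auto
    qed
    have "\<kappa> * min (norm (ghat v - ghat w)) (norm (ghat v + ghat w)) \<le> measure lebesgue (\<Phi> K)"
      unfolding Phi_K by (rule E(4))
    also have "\<dots> \<le> c * measure lebesgue K" by (rule c(2)[OF K])
    also have "\<dots> \<le> c * measure lebesgue L"
    proof (intro mult_left_mono measure_mono_fmeasurable)
      show "K \<subseteq> L" unfolding K_def L_def by (intro set_plus_mono2 sub v w order_refl)
    qed (use K L c(1) in \<open>auto simp: convex_bodiesD lmeasurable_compact fmeasurableD\<close>)
    also have "\<dots> \<le> c * (C * min (norm ((1 / m) *\<^sub>R v - (1 / m) *\<^sub>R w)) (norm ((1 / m) *\<^sub>R v + (1 / m) *\<^sub>R w)))"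
      unfolding L_def
    proof (intro mult_left_mono C(2) E(1,2))
      fix e assume e: "e \<in> E"
      have "e \<noteq> 0" "norm e = 1" using E(3) e by auto
      then have "norm (g (f e)) = 1" using f[of e] by (metis norm_minus_cancel)
      then show "norm (f e) \<le> 1 / m" using m(2)[of "f e"] m(1) by (simp add: field_simps)
    qed (use v w m(1) c(1) in auto)
    also have "\<dots> = c * (C * (1 / m * min (norm (v - w)) (norm (v + w))))"
      using m(1) by (subst min_norm_diff_add_scaleR) auto
    finally show "min (norm (ghat v - ghat w)) (norm (ghat v + ghat w))
        \<le> c * C / (m * \<kappa>) * min (norm (v - w)) (norm (v + w))"
      using \<kappa>(1) m(1) by (simp add: field_simps)
  qed
qed

section \<open>The integral formula for zonoids and generalized zonoids\<close>

lemma support_function_zonoid_image: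
  assumes "finite_sphere_measure \<mu>" and Z: "Z \<in> convex_bodies"
    and supp: "\<And>u. support_function Z u = integral\<^sup>L \<mu> (\<lambda>v. \<bar>u \<bullet> v\<bar>)"
  shows "support_function (\<Phi> Z) u = integral\<^sup>L \<mu> (\<lambda>v. \<bar>u \<bullet> g v\<bar>)"
proof -
  interpret finite_sphere_measure \<mu> by fact
  define I where "I = integral\<^sup>L \<mu> (\<lambda>v. \<bar>u \<bullet> g v\<bar>)"
  define m where "m = measure \<mu> (space \<mu>)"
  have "0 \<le> m" by (simp add: m_def)
  have bound: "\<bar>support_function (\<Phi> Z) u - I\<bar> \<le> \<epsilon> * (norm u + m)" if "0 < \<epsilon>" for \<epsilon>
  proof -
    obtain \<eta> where \<eta>: "0 < \<eta>" "\<And>L. L \<in> convex_bodies \<Longrightarrow> hausdorff_distance Z L < \<eta> \<Longrightarrow>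
        hausdorff_distance (\<Phi> Z) (\<Phi> L) < \<epsilon>"
      using continuous Z \<open>0 < \<epsilon>\<close> unfolding continuous_wrt_def by meson
    have "uniformly_continuous_on (sphere 0 1) (\<lambda>v. \<bar>u \<bullet> g v\<bar>)"
      by (intro compact_uniformly_continuous continuous_abs_inner_g) auto
    then obtain \<delta>1 where \<delta>1: "0 < \<delta>1" "\<And>x y. x \<in> sphere 0 1 \<Longrightarrow> y \<in> sphere 0 1 \<Longrightarrow> dist x y < \<delta>1 \<Longrightarrow>
        \<bar>\<bar>u \<bullet> g x\<bar> - \<bar>u \<bullet> g y\<bar>\<bar> < \<epsilon>"
      using \<open>0 < \<epsilon>\<close> unfolding uniformly_continuous_on_def dist_real_def by (metis dist_commute)
    \<comment> \<open>The first bound serves the integrand |u \<bullet> g v|; the second gives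
      \<delta> m < \<eta>, which brings the discretized body within \<eta> of
      \<open>Z\<close>.\<close>
    define \<delta> where "\<delta> = min \<delta>1 (\<eta> / (m + 1))"
    have \<delta>: "0 < \<delta>" "\<delta> \<le> \<delta>1" "\<delta> \<le> \<eta> / (m + 1)" using \<delta>1 \<eta> \<open>0 \<le> m\<close> by (auto simp: \<delta>_def)
    obtain T w where T: "finite T" "T \<subseteq> sphere 0 1" "\<And>x. x \<in> T \<Longrightarrow> (0::real) \<le> w x"
      and approx: "\<And>f \<epsilon>. continuous_on (sphere 0 1) f \<Longrightarrow>
      (\<And>x y. x \<in> sphere 0 1 \<Longrightarrow> y \<in> sphere 0 1 \<Longrightarrow> dist x y < \<delta> \<Longrightarrow> \<bar>f x - f y\<bar> \<le> \<epsilon>) \<Longrightarrow>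
      \<bar>(\<Sum>x\<in>T. w x * f x) - integral\<^sup>L \<mu> f\<bar> \<le> \<epsilon> * m"
      unfolding m_def by (rule discretization[OF \<delta>(1)]) blast
    \<comment> \<open>On this finite sum of segments the formula is just additivity together with
      homogeneity of \<open>g\<close>.\<close>
    define Y where "Y = (\<Sum>x\<in>T. sym_segment (w x *\<^sub>R x))"
    have Y: "Y \<in> convex_bodies" unfolding Y_def by (intro sum_in_convex_bodies) auto
    have supp_Y: "support_function Y e = (\<Sum>x\<in>T. w x * \<bar>e \<bullet> x\<bar>)" for e
      unfolding Y_def using T(3) by (subst support_function_sum) (auto simp: abs_mult)
    have "support_function (\<Phi> Y) u = (\<Sum>x\<in>T. \<bar>u \<bullet> g (w x *\<^sub>R x)\<bar>)"
      unfolding Y_def by (simp add: sum support_function_sum Phi_segment)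
    then have supp_PhiY: "support_function (\<Phi> Y) u = (\<Sum>x\<in>T. w x * \<bar>u \<bullet> g x\<bar>)"
      using T(3) by (simp add: abs_inner_g_scaleR)
    \<comment> \<open>For unit \<open>e\<close> the functions |e \<bullet> v| are 1-Lipschitz in
      \<open>v\<close>, so the discretization error is uniform in the direction.\<close>
    have "hausdorff_distance Z Y \<le> \<delta> * m"
    proof (rule hausdorff_distance_le[OF Z Y])
      show "0 \<le> \<delta> * m" using \<delta>(1) \<open>0 \<le> m\<close> by simp
      fix e :: 'a assume e: "norm e = 1"
      have "\<bar>support_function Y e - support_function Z e\<bar> \<le> \<delta> * m"
        unfolding supp_Y supp
      proof (rule approx)
        fix x y :: 'a assume "dist x y < \<delta>"
        then have "\<bar>e \<bullet> (x - y)\<bar> \<le> \<delta>"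
          using Cauchy_Schwarz_ineq2[of e "x - y"] e by (simp add: dist_norm)
        then show "\<bar>\<bar>e \<bullet> x\<bar> - \<bar>e \<bullet> y\<bar>\<bar> \<le> \<delta>" by (auto simp: inner_diff_right)
      qed (intro continuous_intros)
      then show "\<bar>support_function Z e - support_function Y e\<bar> \<le> \<delta> * m" by (simp add: abs_minus_commute)
    qed
    also have "\<delta> * m \<le> \<eta> / (m + 1) * m" using \<delta>(3) \<open>0 \<le> m\<close> by (rule mult_right_mono)
    also have "\<dots> < \<eta>" using \<eta>(1) \<open>0 \<le> m\<close> by (simp add: field_simps)
    finally have "hausdorff_distance (\<Phi> Z) (\<Phi> Y) < \<epsilon>" by (intro \<eta>(2) Y)
    then have "norm u * hausdorff_distance (\<Phi> Z) (\<Phi> Y) \<le> norm u * \<epsilon>" by (intro mult_left_mono) auto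
    then have "\<bar>support_function (\<Phi> Z) u - support_function (\<Phi> Y) u\<bar> \<le> norm u * \<epsilon>"
      using support_function_diff_le[of "\<Phi> Z" "\<Phi> Y" u] Z Y by simp
    moreover have "\<bar>support_function (\<Phi> Y) u - I\<bar> \<le> \<epsilon> * m"
      unfolding supp_PhiY I_def
      using \<delta>1(2) \<delta>(2) by (intro approx continuous_abs_inner_g less_imp_le) auto
    ultimately show ?thesis by (simp add: distrib_left mult.commute)
  qed
  have "\<bar>support_function (\<Phi> Z) u - I\<bar> \<le> 0 + \<epsilon>" if "0 < \<epsilon>" for \<epsilon>
  proof -
    define k where "k = norm u + m + 1"
    have "0 < k" using \<open>0 \<le> m\<close> by (simp add: k_def add_nonneg_pos)
    have "\<bar>support_function (\<Phi> Z) u - I\<bar> \<le> \<epsilon> / k * (norm u + m)"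
      using \<open>0 < k\<close> \<open>0 < \<epsilon>\<close> by (intro bound) simp
    also have "\<dots> \<le> \<epsilon> / k * k"
      using \<open>0 < k\<close> \<open>0 < \<epsilon>\<close> by (intro mult_left_mono) (auto simp: k_def)
    finally show ?thesis using \<open>0 < k\<close> by simp
  qed
  then have "\<bar>support_function (\<Phi> Z) u - I\<bar> \<le> 0" by (rule field_le_epsilon)
  then show ?thesis by (simp add: I_def)
qed

text \<open>The positive and negative parts of \<rho> generate zonoids \<open>ZP\<close> and
  \<open>ZN\<close> for which Z + ZN is a translate of \<open>ZP\<close>. Additivity and translation
  invariance carry this relation over to the images, and the image of \<open>ZN\<close> is
  subtracted on the level of support functions.\<close>

lemma support_function_generalized_zonoid_image:
  assumes Z: "Z \<in> convex_bodies" and \<rho>: "generating_measure Z \<rho>"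
  shows "support_function (\<Phi> Z) u = signed_integral sphere_borel \<rho> (\<lambda>v. \<bar>u \<bullet> g v\<bar>)"
proof -
  define P where "P = positive_variation (sphere_borel :: 'a measure) \<rho>"
  define N where "N = positive_variation (sphere_borel :: 'a measure) (\<lambda>A. - \<rho> A)"
  have "signed_measure sphere_borel \<rho>" using \<rho> by (simp add: generating_measure_def)
  then have P: "finite_sphere_measure P" and N: "finite_sphere_measure N"
    unfolding P_def N_def
    by (auto intro: finite_sphere_measure_positive_variation signed_measure_uminus)
  obtain v0 where v0: "\<And>u. support_function Z u
      = integral\<^sup>L P (\<lambda>v. \<bar>u \<bullet> v\<bar>) - integral\<^sup>L N (\<lambda>v. \<bar>u \<bullet> v\<bar>) + u \<bullet> v0"
    using \<rho> unfolding generating_measure_def signed_integral_def P_def N_def by blast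
  obtain ZP where ZP: "ZP \<in> convex_bodies" "\<And>u. support_function ZP u = integral\<^sup>L P (\<lambda>v. \<bar>u \<bullet> v\<bar>)"
    by (rule finite_sphere_measure.zonoid_exists[OF P]) blast
  obtain ZN where ZN: "ZN \<in> convex_bodies" "\<And>u. support_function ZN u = integral\<^sup>L N (\<lambda>v. \<bar>u \<bullet> v\<bar>)"
    by (rule finite_sphere_measure.zonoid_exists[OF N]) blast
  have "Z + ZN = (\<lambda>x. x + v0) ` ZP"
    using Z ZP ZN
    by (intro convex_bodies_eqI)
      (auto simp: support_function_plus support_function_translation translation_in_convex_bodies v0)
  then have "\<Phi> Z + \<Phi> ZN = \<Phi> ZP" using translation[OF ZP(1), of v0] plus[OF Z ZN(1)] by simp
  then have "support_function (\<Phi> Z + \<Phi> ZN) u = support_function (\<Phi> ZP) u" by simp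
  then have "support_function (\<Phi> Z) u = support_function (\<Phi> ZP) u - support_function (\<Phi> ZN) u"
    using Z ZN(1) by (simp add: support_function_plus)
  also have "\<dots> = integral\<^sup>L P (\<lambda>v. \<bar>u \<bullet> g v\<bar>) - integral\<^sup>L N (\<lambda>v. \<bar>u \<bullet> g v\<bar>)"
    using support_function_zonoid_image[OF P ZP] support_function_zonoid_image[OF N ZN] by simp
  finally show ?thesis by (simp add: signed_integral_def P_def N_def)
qed

end

section \<open>Lines through the origin\<close>

lemma span_singleton_scaleR:
  fixes v :: "'a::euclidean_space"
  assumes "c \<noteq> 0" shows "span {c *\<^sub>R v} = span {v}"
proof (rule subset_antisym)
  show "span {c *\<^sub>R v} \<subseteq> span {v}" by (intro span_minimal) (auto intro: span_scale span_base)
  have "v = inverse c *\<^sub>R (c *\<^sub>R v)" using assms by simp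
  then have "v \<in> span {c *\<^sub>R v}" by (metis span_scale span_base singletonI)
  then show "span {v} \<subseteq> span {c *\<^sub>R v}" by (intro span_minimal) auto
qed

lemma span_singleton_uminus: "span {- v} = span {v}" for v :: "'a::euclidean_space"
  using span_singleton_scaleR[of "- 1" v] by simp

lemma span_singleton_in_Gr1: "v \<noteq> 0 \<Longrightarrow> span {v} \<in> Gr1"
  by (simp add: Gr1_def dim_eq_card_independent)

lemma Gr1E:
  assumes "E \<in> Gr1" obtains v where "norm v = 1" "E = span {v}"
proof -
  obtain B where B: "B \<subseteq> E" "independent B" "E \<subseteq> span B" "card B = 1"
    using basis_exists[of E] assms by (auto simp: Gr1_def)
  then obtain b where b: "B = {b}" using card_1_singletonE by blast
  have "b \<noteq> 0" using B(2) b by auto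
  then have "span {sgn b} = span {b}" unfolding sgn_div_norm by (intro span_singleton_scaleR) simp
  moreover have "E = span {b}" using B b assms span_minimal[of "{b}" E] by (auto simp: Gr1_def)
  moreover have "norm (sgn b) = 1" using \<open>b \<noteq> 0\<close> by (simp add: norm_sgn)
  ultimately show ?thesis using that by metis
qed

lemma span_singleton_Int_sphere:
  assumes "norm v = 1" shows "span {v} \<inter> sphere 0 1 = {v, - v}"
  using assms by (auto simp: span_singleton abs_if split: if_splits intro: range_eqI[of _ _ "- 1"] range_eqI[of _ _ 1])

lemma infdist_pair: "infdist x {a, b} = min (dist x a) (dist x b)"
  by (simp add: infdist_def cInf_eq_Min)

lemma hausdorff_distance_antipodal:
  fixes v w :: "'a::real_normed_vector"
  shows "hausdorff_distance {v, - v} {w, - w} = min (norm (v - w)) (norm (v + w))"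
proof -
  have "dist v w = norm (v - w)" "dist v (- w) = norm (v + w)" "dist (- v) w = norm (v + w)"
    "dist (- v) (- w) = norm (v - w)" "dist w v = norm (v - w)" "dist w (- v) = norm (v + w)"
    "dist (- w) v = norm (v + w)" "dist (- w) (- v) = norm (v - w)"
    using norm_minus_cancel[of "v + w"]
    by (simp_all add: dist_norm norm_minus_commute add.commute del: norm_minus_cancel)
  then show ?thesis
    unfolding hausdorff_distance_def infdist_pair image_insert image_empty
    by (simp add: cSup_eq_Max min.commute)
qed

text \<open>Translates the minimum over the sign, in which the volume estimates are stated, into the
  metric on lines.\<close>

lemma Gr1_dist_span:
  assumes "norm v = 1" "norm w = 1"
  shows "Gr1_dist (span {v}) (span {w}) = min (norm (v - w)) (norm (v + w))"
  unfolding Gr1_dist_def span_singleton_Int_sphere[OF assms(1)] span_singleton_Int_sphere[OF assms(2)]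
  by (rule hausdorff_distance_antipodal)

lemma orth_proj_span:
  assumes "norm w = 1" shows "orth_proj (span {w}) x = (x \<bullet> w) *\<^sub>R w"
  unfolding orth_proj_def
proof (rule the_equality)
  have ww: "w \<bullet> w = 1" using assms by (simp add: dot_square_norm)
  show "(x \<bullet> w) *\<^sub>R w \<in> span {w} \<and> (\<forall>z\<in>span {w}. orthogonal (x - (x \<bullet> w) *\<^sub>R w) z)"
    by (auto simp: span_singleton orthogonal_def inner_diff_left ww)
  fix y assume y: "y \<in> span {w} \<and> (\<forall>z\<in>span {w}. orthogonal (x - y) z)"
  then obtain s where s: "y = s *\<^sub>R w" by (auto simp: span_singleton)
  have "orthogonal (x - y) w" using y by (simp add: span_base)
  then show "y = (x \<bullet> w) *\<^sub>R w" by (simp add: s orthogonal_def inner_diff_left ww)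
qed

text \<open>In the coordinate along a unit vector \<open>w\<close> of the line, the projection is
  the interval from -|u \<bullet> w| to |u \<bullet> w|.\<close>

lemma line_length_orth_proj_segment:
  fixes p u :: "'a::euclidean_space"
  assumes "p \<noteq> 0"
  shows "line_length (span {p}) (orth_proj (span {p}) ` closed_segment (- u) u) = 2 * \<bar>u \<bullet> p\<bar> / norm p"
proof -
  \<comment> \<open>The very vector selected inside \<open>line_length\<close>; it is
    \<open>sgn p\<close> or its negative, and both give the same interval.\<close>
  define w where "w = (SOME w. w \<in> span {p} \<and> norm w = 1)"
  have sgn: "norm (sgn p) = 1" "span {sgn p} = span {p}"
    using assms by (auto simp: norm_sgn sgn_div_norm intro!: span_singleton_scaleR)
  have "w \<in> span {p} \<and> norm w = 1"
    unfolding w_def by (rule someI[of _ "sgn p"]) (metis sgn span_base singletonI)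
  then have "w \<in> span {sgn p} \<inter> sphere 0 1" by (simp add: sgn)
  then have w: "w = sgn p \<or> w = - sgn p" using span_singleton_Int_sphere[OF sgn(1)] by auto
  then have norm_w: "norm w = 1" and span_w: "span {p} = span {w}"
    using sgn span_singleton_uminus[of "sgn p"] by auto
  have abs_w: "\<bar>u \<bullet> w\<bar> = \<bar>u \<bullet> p\<bar> / norm p"
    using w by (auto simp: sgn_div_norm divide_inverse abs_mult mult.commute)
  have "{t. t *\<^sub>R w \<in> orth_proj (span {p}) ` closed_segment (- u) u} = {- \<bar>u \<bullet> w\<bar>..\<bar>u \<bullet> w\<bar>}"
  proof (rule set_eqI)
    fix t
    have "w \<noteq> 0" using norm_w by auto
    have "t *\<^sub>R w \<in> orth_proj (span {p}) ` closed_segment (- u) u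
        \<longleftrightarrow> (\<exists>s. \<bar>s\<bar> \<le> 1 \<and> t *\<^sub>R w = (s * (u \<bullet> w)) *\<^sub>R w)"
      unfolding span_w image_iff Bex_def sym_segment_def[symmetric] mem_sym_segment
      by (auto simp: orth_proj_span[OF norm_w])
    also have "\<dots> \<longleftrightarrow> (\<exists>s. \<bar>s\<bar> \<le> 1 \<and> t = s * (u \<bullet> w))" using \<open>w \<noteq> 0\<close> by simp
    also have "\<dots> \<longleftrightarrow> \<bar>t\<bar> \<le> \<bar>u \<bullet> w\<bar>"
    proof
      assume "\<exists>s. \<bar>s\<bar> \<le> 1 \<and> t = s * (u \<bullet> w)"
      then obtain s where s: "\<bar>s\<bar> \<le> 1" "t = s * (u \<bullet> w)" by blast
      then have "\<bar>s\<bar> * \<bar>u \<bullet> w\<bar> \<le> 1 * \<bar>u \<bullet> w\<bar>" by (intro mult_right_mono) auto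
      then show "\<bar>t\<bar> \<le> \<bar>u \<bullet> w\<bar>" by (simp add: s(2) abs_mult)
    next
      assume "\<bar>t\<bar> \<le> \<bar>u \<bullet> w\<bar>"
      \<comment> \<open>If u \<bullet> w = 0 then t = 0 as well, and the quotient, 0 by convention,
        is still a valid witness.\<close>
      then show "\<exists>s. \<bar>s\<bar> \<le> 1 \<and> t = s * (u \<bullet> w)"
        by (intro exI[of _ "t / (u \<bullet> w)"]) (cases "u \<bullet> w = 0"; simp add: abs_divide divide_le_eq_1)
    qed
    finally show "t \<in> {t. t *\<^sub>R w \<in> orth_proj (span {p}) ` closed_segment (- u) u}
        \<longleftrightarrow> t \<in> {- \<bar>u \<bullet> w\<bar>..\<bar>u \<bullet> w\<bar>}" by auto
  qed
  then show ?thesis unfolding line_length_def w_def[symmetric] by (simp add: abs_w)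
qed

lemma signed_integral_cong:
  assumes "\<And>v. v \<in> space M \<Longrightarrow> f v = g v"
  shows "signed_integral M \<rho> f = signed_integral M \<rho> g"
  unfolding signed_integral_def
  by (intro arg_cong2[where f = minus] Bochner_Integration.integral_cong refl assms)
    (simp_all add: positive_variation_def space_measure_of_conv)

lemma signed_integral_mult_right:
  "signed_integral M \<rho> (\<lambda>v. c * f v) = c * signed_integral M \<rho> f"
  by (simp add: signed_integral_def right_diff_distrib)

section \<open>The density and the map on lines\<close>

context volume_comparable_operator
begin

text \<open>Which of the two unit vectors is taken does not affect the density or the map below,
  because \<open>g (- v)\<close> is \<open>g v\<close> up to sign.\<close>

definition unit_in :: "'a set \<Rightarrow> 'a" where
  "unit_in E = (SOME v. v \<in> E \<and> norm v = 1)"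

definition line_density :: "'a set \<Rightarrow> real" where
  "line_density E = norm (g (unit_in E))"

definition line_map :: "'a set \<Rightarrow> 'a set" where
  "line_map E = span {g (unit_in E)}"

lemma unit_in_span:
  assumes "norm v = 1" shows "unit_in (span {v}) = v \<or> unit_in (span {v}) = - v"
proof -
  have "unit_in (span {v}) \<in> span {v} \<and> norm (unit_in (span {v})) = 1"
    unfolding unit_in_def by (rule someI[of _ v]) (simp add: span_base assms)
  then have "unit_in (span {v}) \<in> span {v} \<inter> sphere 0 1" by simp
  then show ?thesis unfolding span_singleton_Int_sphere[OF assms] by simp
qed

lemma line_density_span: "norm v = 1 \<Longrightarrow> line_density (span {v}) = norm (g v)"
  unfolding line_density_def using unit_in_span[of v] g_uminus[of v] by (metis norm_minus_cancel)

lemma line_map_span: "norm v = 1 \<Longrightarrow> line_map (span {v}) = span {g v}"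
  unfolding line_map_def using unit_in_span[of v] g_uminus[of v] by (metis span_singleton_uminus)

lemma span_ghat: "v \<noteq> 0 \<Longrightarrow> span {ghat v} = span {g v}"
  by (intro span_singleton_scaleR) simp

lemma Gr1_dist_line_map:
  assumes "norm v = 1" "norm w = 1"
  shows "Gr1_dist (line_map (span {v})) (line_map (span {w}))
    = min (norm (ghat v - ghat w)) (norm (ghat v + ghat w))"
proof -
  have "v \<noteq> 0" "w \<noteq> 0" using assms by auto
  note nz = this
  have "Gr1_dist (line_map (span {v})) (line_map (span {w})) = Gr1_dist (span {ghat v}) (span {ghat w})"
    by (simp only: line_map_span[OF assms(1)] line_map_span[OF assms(2)] span_ghat[OF nz(1)] span_ghat[OF nz(2)])
  also have "\<dots> = min (norm (ghat v - ghat w)) (norm (ghat v + ghat w))"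
    by (intro Gr1_dist_span norm_ghat nz)
  finally show ?thesis .
qed

lemma bi_lipschitz_line_map: "bi_lipschitz_wrt Gr1 Gr1_dist line_map"
proof -
  obtain c where c: "0 < c" "\<And>v w. norm v = 1 \<Longrightarrow> norm w = 1 \<Longrightarrow>
      c * min (norm (v - w)) (norm (v + w)) \<le> min (norm (ghat v - ghat w)) (norm (ghat v + ghat w))"
    by (rule ghat_lipschitz_lower) blast
  obtain C where C: "0 < C" "\<And>v w. norm v = 1 \<Longrightarrow> norm w = 1 \<Longrightarrow>
      min (norm (ghat v - ghat w)) (norm (ghat v + ghat w)) \<le> C * min (norm (v - w)) (norm (v + w))"
    by (rule ghat_lipschitz_upper) blast
  have "c * Gr1_dist E F \<le> Gr1_dist (line_map E) (line_map F) \<and>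
      Gr1_dist (line_map E) (line_map F) \<le> C * Gr1_dist E F"
    if E: "E \<in> Gr1" and F: "F \<in> Gr1" for E F
  proof -
    obtain v where v: "norm v = 1" "E = span {v}" using E by (rule Gr1E)
    obtain w where w: "norm w = 1" "F = span {w}" using F by (rule Gr1E)
    show ?thesis unfolding v(2) w(2) Gr1_dist_line_map[OF v(1) w(1)] Gr1_dist_span[OF v(1) w(1)]
      using c(2)[OF v(1) w(1)] C(2)[OF v(1) w(1)] by blast
  qed
  then show ?thesis unfolding bi_lipschitz_wrt_def using c(1) C(1) by blast
qed

text \<open>Injectivity comes from the lower Lipschitz constant, surjectivity from
  \<open>g_surj\<close> after rescaling the preimage to a unit vector.\<close>

lemma bij_betw_line_map: "bij_betw line_map Gr1 Gr1"
  unfolding bij_betw_def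
proof
  show "inj_on line_map Gr1"
  proof (rule inj_onI)
    fix E F :: "'a set" assume E: "E \<in> Gr1" and F: "F \<in> Gr1" and eq: "line_map E = line_map F"
    obtain c where c: "0 < c" "c * Gr1_dist E F \<le> Gr1_dist (line_map E) (line_map F)"
      using bi_lipschitz_line_map E F unfolding bi_lipschitz_wrt_def by blast
    obtain v where v: "norm v = 1" "E = span {v}" using E by (rule Gr1E)
    obtain w where w: "norm w = 1" "F = span {w}" using F by (rule Gr1E)
    have "Gr1_dist (line_map E) (line_map F) = 0"
      unfolding eq w(2) Gr1_dist_line_map[OF w(1) w(1)] by simp
    then have "Gr1_dist E F \<le> 0" using c by (simp add: mult_le_0_iff)
    then have "v = w \<or> v = - w"
      unfolding v(2) w(2) Gr1_dist_span[OF v(1) w(1)] by (auto simp: min_le_iff_disj eq_neg_iff_add_eq_0)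
    then show "E = F" using v(2) w(2) span_singleton_uminus[of w] by auto
  qed
  show "line_map ` Gr1 = Gr1"
  proof (rule subset_antisym)
    show "line_map ` Gr1 \<subseteq> Gr1"
    proof clarify
      fix E :: "'a set" assume "E \<in> Gr1"
      then obtain v where v: "norm v = 1" "E = span {v}" by (rule Gr1E)
      then have "g v \<noteq> 0" by auto
      then show "line_map E \<in> Gr1" unfolding v(2) line_map_span[OF v(1)] by (rule span_singleton_in_Gr1)
    qed
    show "Gr1 \<subseteq> line_map ` Gr1"
    proof
      fix E :: "'a set" assume "E \<in> Gr1"
      then obtain y where y: "norm y = 1" "E = span {y}" by (rule Gr1E)
      then have "y \<noteq> 0" by auto
      then obtain v where v: "v \<noteq> 0" "y = g v \<or> y = - g v" by (rule g_surj)
      have sgn: "norm (sgn v) = 1" using v(1) by (simp add: norm_sgn)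
      have "line_map (span {sgn v}) = span {g (sgn v)}" by (rule line_map_span[OF sgn])
      also have "\<dots> = span {inverse (norm v) *\<^sub>R g v}"
        unfolding sgn_div_norm using g_scaleR[of "inverse (norm v)" v] by (metis span_singleton_uminus)
      also have "\<dots> = span {g v}" using v(1) by (intro span_singleton_scaleR) simp
      also have "\<dots> = E" using v(2) y(2) span_singleton_uminus[of "g v"] by auto
      finally have "E = line_map (span {sgn v})" by simp
      moreover have "span {sgn v} \<in> Gr1" using v(1) by (intro span_singleton_in_Gr1) (simp add: sgn_zero_iff)
      ultimately show "E \<in> line_map ` Gr1" by blast
    qed
  qed
qed

lemma line_density_pos: "E \<in> Gr1 \<Longrightarrow> 0 < line_density E"
  by (erule Gr1E) (auto simp: line_density_span)

text \<open>If two lines are close, one of the unit vectors of the second is close to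
  \<open>v\<close>, and the norm of \<open>g\<close> agrees at antipodes.\<close>

lemma continuous_line_density: "continuous_wrt Gr1 Gr1_dist dist line_density"
  unfolding continuous_wrt_def
proof (intro ballI allI impI)
  fix E :: "'a set" and \<epsilon> :: real assume E: "E \<in> Gr1" and \<epsilon>: "0 < \<epsilon>"
  obtain v where v: "norm v = 1" "E = span {v}" using E by (rule Gr1E)
  obtain \<delta> where \<delta>: "0 < \<delta>" "\<And>w. dist w v < \<delta> \<Longrightarrow> dist (norm (g w)) (norm (g v)) < \<epsilon>"
    using continuous_norm_g[of UNIV] \<epsilon> unfolding continuous_on_iff by (metis UNIV_I)
  show "\<exists>\<delta>>0. \<forall>F\<in>Gr1. Gr1_dist E F < \<delta> \<longrightarrow> dist (line_density E) (line_density F) < \<epsilon>"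
  proof (intro exI[of _ \<delta>] conjI \<delta>(1) ballI impI)
    fix F assume F: "F \<in> Gr1" and dist: "Gr1_dist E F < \<delta>"
    obtain w where w: "norm w = 1" "F = span {w}" using F by (rule Gr1E)
    have "dist w v < \<delta> \<or> dist (- w) v < \<delta>"
      using dist norm_minus_cancel[of "v + w"] unfolding v(2) w(2) Gr1_dist_span[OF v(1) w(1)]
      by (simp add: min_less_iff_disj dist_norm norm_minus_commute add.commute del: norm_minus_cancel)
    then have "dist (norm (g w)) (norm (g v)) < \<epsilon>"
      using \<delta>(2)[of w] \<delta>(2)[of "- w"] g_uminus[of w] by auto
    then show "dist (line_density E) (line_density F) < \<epsilon>"
      unfolding v(2) w(2) line_density_span[OF v(1)] line_density_span[OF w(1)] by (simp add: dist_commute)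
  qed
qed

text \<open>The norm in the density cancels the one in the length of the projection. What remains is
  2 |u \<bullet> g v|, whence the factor 1/2.\<close>

lemma support_function_generalized_zonoid_image_lines:
  assumes "Z \<in> convex_bodies" "generating_measure Z \<rho>"
  shows "support_function (\<Phi> Z) u = 1 / 2 * signed_integral sphere_borel \<rho>
    (\<lambda>v. line_density (span {v}) *
      line_length (line_map (span {v})) (orth_proj (line_map (span {v})) ` closed_segment (- u) u))"
proof -
  have "signed_integral sphere_borel \<rho> (\<lambda>v. line_density (span {v}) *
      line_length (line_map (span {v})) (orth_proj (line_map (span {v})) ` closed_segment (- u) u))
    = signed_integral sphere_borel \<rho> (\<lambda>v. 2 * \<bar>u \<bullet> g v\<bar>)"
  proof (rule signed_integral_cong)
    fix v :: 'a assume "v \<in> space sphere_borel"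
    then have v: "norm v = 1" by simp
    then have "g v \<noteq> 0" by auto
    then show "line_density (span {v}) *
        line_length (line_map (span {v})) (orth_proj (line_map (span {v})) ` closed_segment (- u) u)
      = 2 * \<bar>u \<bullet> g v\<bar>"
      unfolding line_density_span[OF v] line_map_span[OF v] by (simp add: line_length_orth_proj_segment)
  qed
  then show ?thesis
    using support_function_generalized_zonoid_image[OF assms] by (simp add: signed_integral_mult_right)
qed

end

theorem theorem4p2:
  fixes \<Phi> :: "(real ^ 'n) set \<Rightarrow> (real ^ 'n) set"
  assumes "CARD('n) \<ge> 2"
    and "\<Phi> \<in> MAdd_sym"
    and "volume_condition \<Phi>"
  shows "\<exists>(\<rho>\<^sub>1 :: (real ^ 'n) set \<Rightarrow> real) (\<pi>\<^sub>1 :: (real ^ 'n) set \<Rightarrow> (real ^ 'n) set).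
           continuous_wrt Gr1 Gr1_dist dist \<rho>\<^sub>1 \<and>
           (\<forall>E\<in>Gr1. 0 < \<rho>\<^sub>1 E) \<and>
           bij_betw \<pi>\<^sub>1 Gr1 Gr1 \<and>
           bi_lipschitz_wrt Gr1 Gr1_dist \<pi>\<^sub>1 \<and>
           (\<forall>Z\<in>convex_bodies. \<forall>\<rho>. generating_measure Z \<rho> \<longrightarrow>
              (\<forall>u. support_function (\<Phi> Z) u =
                 1 / 2 * signed_integral sphere_borel \<rho>
                   (\<lambda>v. \<rho>\<^sub>1 (span {v}) *
                        line_length (\<pi>\<^sub>1 (span {v}))
                          (orth_proj (\<pi>\<^sub>1 (span {v})) ` closed_segment (- u) u))))"
proof -
  interpret volume_comparable_operator \<Phi>
    using assms by unfold_locales auto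
  show ?thesis
    by (intro exI[of _ line_density] exI[of _ line_map] conjI ballI allI impI continuous_line_density
        line_density_pos bij_betw_line_map bi_lipschitz_line_map support_function_generalized_zonoid_image_lines)
qed

end
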